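(* Let $n\ge1$ and let $F:H^n\to H^n$ be a quasiconformal map of the Heisenberg group. If $F$ maps vertical lines to vertical lines, then $F$ is biLipschitz.
   Context: $H^n=\mathbb R^{2n}\times\mathbb R$ is the Heisenberg group with group law $(x,t)\cdot(y,s)=(x+y,\,t+s+\frac12\omega(x,y))$, where $\omega$ is the standard symplectic form on $\mathbb R^{2n}$. It is equipped with a left-invariant sub-Riemannian Carnot-Carathéodory metric $d$ associated to the first stratum $V_1=\mathbb R^{2n}\times\{0\}$ of its Lie algebra (with a fixed inner product on $V_1$). Vertical lines are the sets $\{x\}\times\mathbb R$, $x\in\mathbb R^{2n}$ (the left cosets of the center). For a bijection $F:X\to Y$ between metric spaces, $x\in X$ and $t>0$, put $$H_F(x,t)=\frac{\sup\{d(F(x'),F(x)) : d(x',x)\le t\}}{\inf\{d(F(x'),F(x)) : d(x',x)\ge t\}}.$$ $F$ is quasiconformal if $F$ and $F^{-1}$ are continuous and there is $\lambda\ge1$ such that $\limsup_{t\to0}H_F(x,t)\le\lambda$ for all $x\in X$. "$F$ maps vertical lines to vertical lines" means that the image of each vertical line is a vertical line. *)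

theory Defs
  imports "HOL-Analysis.Analysis"
begin

section \<open>Quasiconformal and biLipschitz maps between metric spaces\<close>

text \<open>A metric space is a carrier together with a distance function, as in the locale
  \<^locale>\<open>Metric_space\<close>.

  Supremum, infimum and quotient are taken in \<^typ>\<open>ennreal\<close>. For a homeomorphism \<open>F\<close> of a metric
  space with more than one point and all small \<open>t > 0\<close>, the numerator is finite (continuity of \<open>F\<close>)
  and the denominator is positive (continuity of the inverse) and finite, so the conventions for
  \<open>0 / 0\<close> and \<open>\<infinity> / \<infinity>\<close> do not affect the limit superior at 0.\<close>

definition qc_ratio ::
  "'a set \<Rightarrow> ('a \<Rightarrow> 'a \<Rightarrow> real) \<Rightarrow> ('b \<Rightarrow> 'b \<Rightarrow> real) \<Rightarrow> ('a \<Rightarrow> 'b) \<Rightarrow> 'a \<Rightarrow> real \<Rightarrow> ennreal"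
  where
  "qc_ratio X dX dY F x t =
     (SUP x'\<in>{x'\<in>X. dX x' x \<le> t}. ennreal (dY (F x') (F x))) /
     (INF x'\<in>{x'\<in>X. dX x' x \<ge> t}. ennreal (dY (F x') (F x)))"

definition quasiconformal ::
  "'a set \<Rightarrow> ('a \<Rightarrow> 'a \<Rightarrow> real) \<Rightarrow> 'b set \<Rightarrow> ('b \<Rightarrow> 'b \<Rightarrow> real) \<Rightarrow> ('a \<Rightarrow> 'b) \<Rightarrow> bool"
  where
  "quasiconformal X dX Y dY F \<longleftrightarrow>
     bij_betw F X Y \<and>
     continuous_map (Metric_space.mtopology X dX) (Metric_space.mtopology Y dY) F \<and>
     continuous_map (Metric_space.mtopology Y dY) (Metric_space.mtopology X dX) (inv_into X F) \<and>
     (\<exists>K::real. K \<ge> 1 \<and>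
        (\<forall>x\<in>X. Limsup (at_right 0) (\<lambda>t. qc_ratio X dX dY F x t) \<le> ennreal K))"

definition biLipschitz ::
  "'a set \<Rightarrow> ('a \<Rightarrow> 'a \<Rightarrow> real) \<Rightarrow> 'b set \<Rightarrow> ('b \<Rightarrow> 'b \<Rightarrow> real) \<Rightarrow> ('a \<Rightarrow> 'b) \<Rightarrow> bool"
  where
  "biLipschitz X dX Y dY F \<longleftrightarrow>
     F \<in> X \<rightarrow> Y \<and>
     (\<exists>L::real. L \<ge> 1 \<and>
        (\<forall>p\<in>X. \<forall>q\<in>X. dX p q / L \<le> dY (F p) (F q) \<and> dY (F p) (F q) \<le> L * dX p q))"

section \<open>The Heisenberg group\<close>

text \<open>The horizontal layer \<open>\<real>\<^bsup>2n\<^esup>\<close> is \<open>\<real>\<^sup>n \<times> \<real>\<^sup>n\<close>, where \<open>n\<close> is the cardinality of the index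
  type \<open>'n\<close>; index types are nonempty, so \<open>n \<ge> 1\<close>.\<close>

type_synonym 'n horiz = "(real, 'n) vec \<times> (real, 'n) vec"
type_synonym 'n heis = "'n horiz \<times> real"

definition symp :: "'n::finite horiz \<Rightarrow> 'n horiz \<Rightarrow> real" where
  "symp x y = fst x \<bullet> snd y - snd x \<bullet> fst y"

definition heis_mult :: "'n::finite heis \<Rightarrow> 'n heis \<Rightarrow> 'n heis" where
  "heis_mult p q = (fst p + fst q, snd p + snd q + symp (fst p) (fst q) / 2)"

definition vertical_line :: "'n::finite heis set \<Rightarrow> bool" where
  "vertical_line l \<longleftrightarrow> (\<exists>x. l = {x} \<times> UNIV)"

text \<open>The value at \<open>p\<close> of the left-invariant vector field that equals \<open>(v, 0)\<close> at the identity,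
  i.e. the image of \<open>(v, 0)\<close> under the differential of left translation by \<open>p\<close>; see the lemma.\<close>

definition left_field :: "'n::finite heis \<Rightarrow> 'n horiz \<Rightarrow> 'n heis" where
  "left_field p v = (v, symp (fst p) v / 2)"

lemma left_field_derivative_left_translation:
  "((\<lambda>s. heis_mult p (s *\<^sub>R v, 0)) has_vector_derivative left_field p v) (at 0)"
proof -
  have "heis_mult p (s *\<^sub>R v, 0) = p + s *\<^sub>R left_field p v" for s
    by (simp add: heis_mult_def left_field_def symp_def prod_eq_iff algebra_simps diff_divide_distrib)
  moreover have "((\<lambda>s. p + s *\<^sub>R left_field p v) has_vector_derivative left_field p v) (at 0)"
    by (auto intro!: derivative_eq_intros)
  ultimately show ?thesis by simp
qed

section \<open>The Carnot-Caratheodory metric\<close>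

definition inner_product :: "('a::real_vector \<Rightarrow> 'a \<Rightarrow> real) \<Rightarrow> bool" where
  "inner_product g \<longleftrightarrow>
     bilinear g \<and> (\<forall>u v. g u v = g v u) \<and> (\<forall>v. v \<noteq> 0 \<longrightarrow> g v v > 0)"

text \<open>Absolute continuity of a curve on \<open>[a, b]\<close>. A division of \<open>\<Union>\<D>\<close> is a finite family of
  nonoverlapping compact intervals.\<close>

definition abs_continuous_curve_on :: "real \<Rightarrow> real \<Rightarrow> (real \<Rightarrow> 'a::real_normed_vector) \<Rightarrow> bool"
  where
  "abs_continuous_curve_on a b \<gamma> \<longleftrightarrow>
     (\<forall>\<epsilon>>0. \<exists>\<delta>>0. \<forall>\<D>. \<D> division_of \<Union>\<D> \<and> \<Union>\<D> \<subseteq> {a..b} \<and> (\<Sum>K\<in>\<D>. Sup K - Inf K) < \<delta>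
        \<longrightarrow> (\<Sum>K\<in>\<D>. norm (\<gamma> (Sup K) - \<gamma> (Inf K))) < \<epsilon>)"

definition horizontal_curve :: "(real \<Rightarrow> 'n::finite heis) \<Rightarrow> bool" where
  "horizontal_curve \<gamma> \<longleftrightarrow>
     abs_continuous_curve_on 0 1 \<gamma> \<and>
     (AE t in lebesgue. t \<in> {0<..<1} \<longrightarrow>
        (\<exists>v. (\<gamma> has_vector_derivative left_field (\<gamma> t) v) (at t)))"

text \<open>The inner product \<open>g\<close> on the first layer is extended to a left-invariant one on the horizontal
  distribution, so the horizontal vector \<open>left_field p v\<close> has norm \<open>sqrt (g v v)\<close>. The speed of an
  absolutely continuous curve is integrable on \<open>[0, 1]\<close>.\<close>

definition cc_length :: "('n::finite horiz \<Rightarrow> 'n horiz \<Rightarrow> real) \<Rightarrow> (real \<Rightarrow> 'n heis) \<Rightarrow> real" where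
  "cc_length g \<gamma> =
     integral {0..1} (\<lambda>t. let v = fst (vector_derivative \<gamma> (at t)) in sqrt (g v v))"

text \<open>Any two points are joined by a horizontal curve, so the infimum is over a nonempty set of
  nonnegative reals.\<close>

definition cc_dist :: "('n::finite horiz \<Rightarrow> 'n horiz \<Rightarrow> real) \<Rightarrow> 'n heis \<Rightarrow> 'n heis \<Rightarrow> real" where
  "cc_dist g p q = Inf {cc_length g \<gamma> |\<gamma>. horizontal_curve \<gamma> \<and> \<gamma> 0 = p \<and> \<gamma> 1 = q}"

end

theory Submission
  imports Defs
begin

text \<open>A horizontal step of length \<open>r\<close> from a vertical line \<open>L\<close> ends on a line at distance \<open>r\<close> from \<open>L\<close>,
  and the distance of the images of these two lines does not depend on the starting point. So at
  all points \<open>p\<close> of \<open>L\<close> the map \<open>F\<close> has the same distortion at scale \<open>r\<close>, up to a constant, once \<open>r\<close>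
  is smaller than a scale that depends on \<open>p\<close>. By the Baire category theorem this scale is uniform
  on some interval of \<open>L\<close>. The metric on \<open>L\<close> is \<open>\<kappa> sqrt \<bar>s - t\<bar>\<close>, so heights add up along \<open>L\<close>:
  cutting the interval into equal pieces shows that the distortion at scale \<open>r\<close> is \<open>a r\<close> up to a
  constant, first on this interval, then infinitesimally everywhere on \<open>L\<close>, and, after integration
  along \<open>L\<close>, at all scales. The factor \<open>a\<close> is locally bounded as a function of the line, hence \<open>F\<close>
  moves two given lines apart by a bounded amount; comparison of points at large height on the two
  lines shows that the factors of any two lines agree up to a constant. Therefore \<open>F\<close> and its
  inverse are locally, hence globally, Lipschitz. No passage from quasiconformality to
  quasisymmetry is needed.\<close>

text \<open>Quasiconformality is a limit superior at each single point, so the scale at which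
  \<open>\<Lambda>\<close> takes effect may shrink arbitrarily from point to point. On one fibre a
  uniform scale on some interval is enough: increments at any other point of the fibre are compared
  with those at a point of this interval. Linear growth is special to the vertical direction. There
  \<open>d\<close> is the square root of a quantity that adds up along the fibre, and increments
  that are comparable at all base points of an interval then have to be proportional to the step,
  whereas a comparison around a single centre would allow any power. Of the Carnot-Caratheodory
  metric only the properties collected in \<open>fibred_metric\<close> enter; integration along
  absolutely continuous curves is needed for \<open>proj\<close> and for
  \<open>\<kappa> > 0\<close>. The constant \<open>C\<close> depends on \<open>\<Lambda>\<close>
  only, and \<open>scale x\<close> carries the dependence on the fibre. This is why the comparison
  at large height yields \<open>C\<^sup>2\<close>, with no loss from the distance of the two fibres.
  The inverse of \<open>F\<close> is treated through lower bounds for \<open>F\<close> and the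
  continuity of the inverse.\<close>

subsection \<open>Monotone functions with comparable increments\<close>

text \<open>\<open>additive\<close> expresses monotonicity without fixing its direction. Absolute
  increments then add up over consecutive steps.\<close>

lemma increment_bounds_of_uniform_partition:
  fixes h :: "real \<Rightarrow> real"
  assumes additive: "\<And>u v w. u \<le> v \<Longrightarrow> v \<le> w \<Longrightarrow> \<bar>h w - h u\<bar> = \<bar>h v - h u\<bar> + \<bar>h w - h v\<bar>"
    and "e \<ge> 0"
  shows "(\<And>k. k < n \<Longrightarrow> \<bar>h (a + real k * e + e) - h (a + real k * e)\<bar> \<le> B) \<Longrightarrow>
      \<bar>h (a + real n * e) - h a\<bar> \<le> real n * B"
    and "(\<And>k. k < n \<Longrightarrow> B \<le> \<bar>h (a + real k * e + e) - h (a + real k * e)\<bar>) \<Longrightarrow>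
      real n * B \<le> \<bar>h (a + real n * e) - h a\<bar>"
proof -
  have step: "\<bar>h (a + real (Suc n) * e) - h a\<bar>
      = \<bar>h (a + real n * e) - h a\<bar> + \<bar>h (a + real n * e + e) - h (a + real n * e)\<bar>" for n
    using additive[of a "a + real n * e" "a + real n * e + e"] \<open>e \<ge> 0\<close>
    by (simp add: algebra_simps)
  show "\<bar>h (a + real n * e) - h a\<bar> \<le> real n * B"
    if "\<And>k. k < n \<Longrightarrow> \<bar>h (a + real k * e + e) - h (a + real k * e)\<bar> \<le> B"
    using that
  proof (induction n)
    case (Suc n)
    then have "\<bar>h (a + real n * e) - h a\<bar> \<le> real n * B"
      "\<bar>h (a + real n * e + e) - h (a + real n * e)\<bar> \<le> B" by auto
    then show ?case unfolding step by (simp add: algebra_simps)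
  qed simp
  show "real n * B \<le> \<bar>h (a + real n * e) - h a\<bar>"
    if "\<And>k. k < n \<Longrightarrow> B \<le> \<bar>h (a + real k * e + e) - h (a + real k * e)\<bar>"
    using that
  proof (induction n)
    case (Suc n)
    then have "real n * B \<le> \<bar>h (a + real n * e) - h a\<bar>"
      "B \<le> \<bar>h (a + real n * e + e) - h (a + real n * e)\<bar>" by auto
    then show ?case unfolding step by (simp add: algebra_simps)
  qed simp
qed

text \<open>Cutting \<open>{a..b}\<close> into n equal pieces makes the total increment n times that
  of a comparable step, up to \<open>M\<close>; so an increment is about its step times the mean
  slope \<open>A\<close>. Only base points have to lie in \<open>{a..b}\<close>;
  \<open>t + e\<close> may leave it. The factor 4 absorbs the rounding of n.\<close>

lemma comparable_increments_imp_linear_increments: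
  fixes h :: "real \<Rightarrow> real"
  assumes additive: "\<And>u v w. u \<le> v \<Longrightarrow> v \<le> w \<Longrightarrow> \<bar>h w - h u\<bar> = \<bar>h v - h u\<bar> + \<bar>h w - h v\<bar>"
    and "a < b" "h a \<noteq> h b" "\<delta> > 0" "M > 0"
    and compare: "\<And>t1 t2 e1 e2. t1 \<in> {a..b} \<Longrightarrow> t2 \<in> {a..b} \<Longrightarrow> \<bar>e1\<bar> < \<bar>e2\<bar> \<Longrightarrow> \<bar>e1\<bar> < \<delta> \<Longrightarrow>
      \<bar>h (t1 + e1) - h t1\<bar> \<le> M * \<bar>h (t2 + e2) - h t2\<bar>"
  obtains A \<eta> where "A > 0" "\<eta> > 0"
    "\<And>t e. t \<in> {a..b} \<Longrightarrow> \<bar>e\<bar> < \<eta> \<Longrightarrow> \<bar>h (t + e) - h t\<bar> \<le> 4 * M * A * \<bar>e\<bar>"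
    "\<And>t e. t \<in> {a..b} \<Longrightarrow> \<bar>e\<bar> < \<eta> \<Longrightarrow> A * \<bar>e\<bar> \<le> 4 * M * \<bar>h (t + e) - h t\<bar>"
proof
  define l where "l = b - a"
  define H where "H = \<bar>h b - h a\<bar>"
  have l: "l > 0" and H: "H > 0" using assms by (auto simp: l_def H_def)
  show "H / l > 0" "min \<delta> (l / 4) > 0" using l H \<open>\<delta> > 0\<close> by auto
  fix t e assume t: "t \<in> {a..b}" and e: "\<bar>e\<bar> < min \<delta> (l / 4)"
  show "\<bar>h (t + e) - h t\<bar> \<le> 4 * M * (H / l) * \<bar>e\<bar>"
  proof (cases "e = 0")
    case False
    \<comment> \<open>Rounding down makes the pieces at least twice as long as |e|, hence strictly
      longer, as \<open>compare\<close> demands; |e| < l / 4 limits the loss from rounding to a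
      factor 2.\<close>
    define n where "n = nat \<lfloor>l / (2 * \<bar>e\<bar>)\<rfloor>"
    have q: "l / (2 * \<bar>e\<bar>) \<ge> 2" using e False by (simp add: field_simps)
    have n1: "real n \<le> l / (2 * \<bar>e\<bar>)" and n2: "real n > l / (2 * \<bar>e\<bar>) - 1"
      unfolding n_def using q by linarith+
    have n: "real n > 0" "real n \<ge> l / (4 * \<bar>e\<bar>)" using n2 q by auto
    define e0 where "e0 = l / real n"
    have e0: "e0 \<ge> 2 * \<bar>e\<bar>" unfolding e0_def using n1 n False by (simp add: field_simps)
    have "real n * (\<bar>h (t + e) - h t\<bar> / M) \<le> \<bar>h (a + real n * e0) - h a\<bar>"
    proof (rule increment_bounds_of_uniform_partition(2)[OF additive])
      show "e0 \<ge> 0" using e0 by linarith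
      fix k assume "k < n"
      then have "real k * e0 \<le> real n * e0" using e0 by (intro mult_right_mono) auto
      moreover have "real k * e0 \<ge> 0" using e0 by (intro mult_nonneg_nonneg) auto
      moreover have "real n * e0 = b - a" using n by (simp add: e0_def l_def)
      ultimately have "a + real k * e0 \<in> {a..b}" by simp
      from compare[OF t this, of e e0]
      show "\<bar>h (t + e) - h t\<bar> / M \<le> \<bar>h (a + real k * e0 + e0) - h (a + real k * e0)\<bar>"
        using e e0 False \<open>M > 0\<close> by (simp add: field_simps)
    qed
    also have "\<dots> = H" using n by (simp add: e0_def l_def H_def)
    finally have "real n * (\<bar>h (t + e) - h t\<bar> / M) \<le> H" .
    moreover have "l / (4 * \<bar>e\<bar>) * (\<bar>h (t + e) - h t\<bar> / M) \<le> real n * (\<bar>h (t + e) - h t\<bar> / M)"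
      using n \<open>M > 0\<close> by (intro mult_right_mono) auto
    ultimately have "l / (4 * \<bar>e\<bar>) * (\<bar>h (t + e) - h t\<bar> / M) \<le> H" by linarith
    then show ?thesis using l False \<open>M > 0\<close> by (simp add: field_simps)
  qed simp
  show "(H / l) * \<bar>e\<bar> \<le> 4 * M * \<bar>h (t + e) - h t\<bar>"
  proof (cases "e = 0")
    case False
    \<comment> \<open>Here the pieces must be strictly shorter than |e|, hence one more than the
      floor.\<close>
    define n where "n = nat \<lfloor>l / \<bar>e\<bar>\<rfloor> + 1"
    have "\<bar>e\<bar> \<le> l" using e l by linarith
    then have q: "l / \<bar>e\<bar> \<ge> 1" using False by (simp add: field_simps)
    have n1: "real n > l / \<bar>e\<bar>" and n2: "real n \<le> l / \<bar>e\<bar> + 1"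
      unfolding n_def using q by linarith+
    have n: "real n > 0" "real n \<le> 4 * (l / \<bar>e\<bar>)" using n1 n2 q by linarith+
    define e0 where "e0 = l / real n"
    have e0: "e0 < \<bar>e\<bar>" "e0 > 0" unfolding e0_def using n1 n False l by (simp_all add: field_simps)
    have "H = \<bar>h (a + real n * e0) - h a\<bar>" using n by (simp add: e0_def l_def H_def)
    also have "\<dots> \<le> real n * (M * \<bar>h (t + e) - h t\<bar>)"
    proof (rule increment_bounds_of_uniform_partition(1)[OF additive])
      show "e0 \<ge> 0" using e0 by linarith
      fix k assume "k < n"
      then have "real k * e0 \<le> real n * e0" using e0 by (intro mult_right_mono) auto
      moreover have "real k * e0 \<ge> 0" using e0 by (intro mult_nonneg_nonneg) auto
      moreover have "real n * e0 = b - a" using n by (simp add: e0_def l_def)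
      ultimately have "a + real k * e0 \<in> {a..b}" by simp
      from compare[OF this t, of e0 e]
      show "\<bar>h (a + real k * e0 + e0) - h (a + real k * e0)\<bar> \<le> M * \<bar>h (t + e) - h t\<bar>"
        using e e0 False by simp
    qed
    also have "\<dots> \<le> 4 * (l / \<bar>e\<bar>) * (M * \<bar>h (t + e) - h t\<bar>)"
      using n \<open>M > 0\<close> by (intro mult_right_mono) auto
    finally show ?thesis using l False by (simp add: field_simps)
  qed simp
qed

text \<open>The \<open>\<delta>\<close> depends on \<open>t\<close>, so the argument is by
  bisection. Splitting a short interval at the point \<open>t\<close> inside it costs nothing, as
  increments add; \<open>B\<close> therefore passes unchanged from the local to the global
  bound.\<close>

lemma locally_linear_increments_imp_linear:
  fixes h :: "real \<Rightarrow> real"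
  assumes additive: "\<And>u v w. u \<le> v \<Longrightarrow> v \<le> w \<Longrightarrow> \<bar>h w - h u\<bar> = \<bar>h v - h u\<bar> + \<bar>h w - h v\<bar>"
  shows "(\<And>t. \<exists>\<delta>>0. \<forall>e. \<bar>e\<bar> < \<delta> \<longrightarrow> \<bar>h (t + e) - h t\<bar> \<le> B * \<bar>e\<bar>) \<Longrightarrow> \<bar>h s - h t\<bar> \<le> B * \<bar>s - t\<bar>"
    and "(\<And>t. \<exists>\<delta>>0. \<forall>e. \<bar>e\<bar> < \<delta> \<longrightarrow> B * \<bar>e\<bar> \<le> \<bar>h (t + e) - h t\<bar>) \<Longrightarrow> B * \<bar>s - t\<bar> \<le> \<bar>h s - h t\<bar>"
proof -
  show "\<bar>h s - h t\<bar> \<le> B * \<bar>s - t\<bar>"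
    if *: "\<And>t. \<exists>\<delta>>0. \<forall>e. \<bar>e\<bar> < \<delta> \<longrightarrow> \<bar>h (t + e) - h t\<bar> \<le> B * \<bar>e\<bar>"
  proof -
    have "\<bar>h v - h u\<bar> \<le> B * (v - u)" if "u \<le> v" for u v
      using that
    proof (induction rule: Bolzano)
      case (trans a b c)
      then show ?case by (simp add: additive[of a b c] algebra_simps)
    next
      case (local x)
      from *[of x] obtain \<delta> where d: "\<delta> > 0" "\<And>e. \<bar>e\<bar> < \<delta> \<Longrightarrow> \<bar>h (x + e) - h x\<bar> \<le> B * \<bar>e\<bar>" by blast
      have "\<bar>h b - h a\<bar> \<le> B * (b - a)" if "a \<le> x" "x \<le> b" "b - a < \<delta>" for a b
        using d(2)[of "a - x"] d(2)[of "b - x"] that additive[of a x b]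
        by (simp add: right_diff_distrib abs_minus_commute)
      with d(1) show ?case by blast
    qed
    from this[of s t] this[of t s] show ?thesis by (cases "s \<le> t") (auto simp: abs_minus_commute)
  qed
  show "B * \<bar>s - t\<bar> \<le> \<bar>h s - h t\<bar>"
    if *: "\<And>t. \<exists>\<delta>>0. \<forall>e. \<bar>e\<bar> < \<delta> \<longrightarrow> B * \<bar>e\<bar> \<le> \<bar>h (t + e) - h t\<bar>"
  proof -
    have "B * (v - u) \<le> \<bar>h v - h u\<bar>" if "u \<le> v" for u v
      using that
    proof (induction rule: Bolzano)
      case (trans a b c)
      then show ?case by (simp add: additive[of a b c] algebra_simps)
    next
      case (local x)
      from *[of x] obtain \<delta> where d: "\<delta> > 0" "\<And>e. \<bar>e\<bar> < \<delta> \<Longrightarrow> B * \<bar>e\<bar> \<le> \<bar>h (x + e) - h x\<bar>" by blast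
      have "B * (b - a) \<le> \<bar>h b - h a\<bar>" if "a \<le> x" "x \<le> b" "b - a < \<delta>" for a b
        using d(2)[of "a - x"] d(2)[of "b - x"] that additive[of a x b]
        by (simp add: right_diff_distrib abs_minus_commute)
      with d(1) show ?case by blast
    qed
    from this[of s t] this[of t s] show ?thesis by (cases "s \<le> t") (auto simp: abs_minus_commute)
  qed
qed

subsection \<open>Metrics with parallel fibres\<close>

text \<open>\<open>N (y - x)\<close> is the distance from any point over \<open>x\<close> to the fibre over \<open>y\<close>, realised by a lift of
  the straight segment.\<close>

locale fibred_metric = Metric_space UNIV d
  for d :: "'a::real_vector \<times> real \<Rightarrow> 'a \<times> real \<Rightarrow> real" +
  fixes N :: "'a \<Rightarrow> real" and \<kappa> :: real
  assumes \<kappa>_pos: "\<kappa> > 0"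
    and vert: "d (x, s) (x, t) = \<kappa> * sqrt \<bar>s - t\<bar>"
    and N_scale: "N (c *\<^sub>R v) = \<bar>c\<bar> * N v"
    and N_nontrivial: "\<exists>v. N v > 0"
    and proj: "N (y - x) \<le> d (x, s) (y, t)"
    and segment: "\<exists>\<sigma>. \<sigma> 0 = t \<and>
      (\<forall>u v. d (x + u *\<^sub>R (y - x), \<sigma> u) (x + v *\<^sub>R (y - x), \<sigma> v) \<le> \<bar>u - v\<bar> * N (y - x))"
begin

lemma lift: obtains s where "d (x, t) (y, s) = N (y - x)"
proof -
  obtain \<sigma> where "\<sigma> 0 = t"
    "\<And>u v. d (x + u *\<^sub>R (y - x), \<sigma> u) (x + v *\<^sub>R (y - x), \<sigma> v) \<le> \<bar>u - v\<bar> * N (y - x)"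
    using segment[of t x y] by blast
  from this(1) this(2)[of 0 1] have "d (x, t) (y, \<sigma> 1) \<le> N (y - x)" by simp
  with proj[of y x t "\<sigma> 1"] that show thesis by force
qed

lemma N_nonneg: "N v \<ge> 0"
proof -
  obtain s where "d (0, 0) (v, s) = N (v - 0)" by (rule lift)
  then show ?thesis by (metis diff_zero nonneg)
qed

lemma N_onto: assumes "r \<ge> 0" obtains v where "N v = r"
proof -
  obtain v where "N v > 0" using N_nontrivial by blast
  then have "N ((r / N v) *\<^sub>R v) = r" using assms by (simp add: N_scale)
  with that show thesis .
qed

lemma vert_onto: assumes "r \<ge> 0" obtains s where "d (x, t) (x, s) = r"
proof -
  have "d (x, t) (x, t + (r / \<kappa>)\<^sup>2) = r" using assms \<kappa>_pos by (simp add: vert)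
  with that show thesis .
qed

lemma reverse_triangle: "\<bar>d p q - d p' q'\<bar> \<le> d p p' + d q q'"
  using triangle[of p p' q] triangle[of p' q' q] triangle[of p' p q'] triangle[of p q q']
  by (simp add: commute abs_le_iff)

lemma locally_Lipschitz_curve:
  assumes "a \<le> b"
    and local: "\<And>s. a \<le> s \<Longrightarrow> s \<le> b \<Longrightarrow>
      \<exists>\<delta>>0. \<forall>u. \<bar>u - s\<bar> < \<delta> \<longrightarrow> d (c u) (c s) \<le> K * \<bar>u - s\<bar>"
  shows "d (c a) (c b) \<le> K * (b - a)"
  using assms(1)
proof (induction rule: Bolzano)
  case (trans u v w)
  then show ?case using triangle[of "c u" "c v" "c w"] by (simp add: algebra_simps)
next
  case (local x)
  then obtain \<delta> where d: "\<delta> > 0" "\<And>u. \<bar>u - x\<bar> < \<delta> \<Longrightarrow> d (c u) (c x) \<le> K * \<bar>u - x\<bar>"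
    using assms(2)[of x] by blast
  have "d (c u) (c v) \<le> K * (v - u)" if "u \<le> x" "x \<le> v" "v - u < \<delta>" for u v
    using d(2)[of u] d(2)[of v] that triangle[of "c u" "c x" "c v"]
    by (simp add: algebra_simps commute)
  with d(1) show ?case by blast
qed

text \<open>The curves of controlled length in a \<open>fibred_metric\<close> are lifts of segments,
  so local Lipschitz bounds are added up along these. The bound is required on whole fibres over the
  segment because the height of the lift is not known.\<close>

lemma locally_Lipschitz_along_segment:
  fixes G :: "'a \<times> real \<Rightarrow> 'a \<times> real"
  assumes "K \<ge> 0"
    and local: "\<And>u t. 0 \<le> u \<Longrightarrow> u \<le> 1 \<Longrightarrow>
      \<exists>\<delta>>0. \<forall>q. d (x + u *\<^sub>R (y - x), t) q < \<delta> \<longrightarrow>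
        d (G (x + u *\<^sub>R (y - x), t)) (G q) \<le> K * d (x + u *\<^sub>R (y - x), t) q"
  obtains s where "d (x, t) (y, s) = N (y - x)" "d (G (x, t)) (G (y, s)) \<le> K * N (y - x)"
proof -
  obtain \<sigma> where \<sigma>: "\<sigma> 0 = t"
    "\<And>u v. d (x + u *\<^sub>R (y - x), \<sigma> u) (x + v *\<^sub>R (y - x), \<sigma> v) \<le> \<bar>u - v\<bar> * N (y - x)"
    using segment[of t x y] by blast
  define p where "p u = (x + u *\<^sub>R (y - x), \<sigma> u)" for u
  have p: "d (p u) (p v) \<le> \<bar>u - v\<bar> * N (y - x)" for u v using \<sigma>(2) by (simp add: p_def)
  have p01: "p 0 = (x, t)" "p 1 = (y, \<sigma> 1)" using \<sigma>(1) by (auto simp: p_def)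
  have "d (G (p 0)) (G (p 1)) \<le> (K * N (y - x)) * (1 - 0)"
  proof (rule locally_Lipschitz_curve)
    fix s :: real assume s: "0 \<le> s" "s \<le> 1"
    obtain \<delta> where \<delta>: "\<delta> > 0" "\<And>q. d (p s) q < \<delta> \<Longrightarrow> d (G (p s)) (G q) \<le> K * d (p s) q"
      using local[OF s] unfolding p_def by blast
    show "\<exists>\<delta>>0. \<forall>u. \<bar>u - s\<bar> < \<delta> \<longrightarrow> d (G (p u)) (G (p s)) \<le> (K * N (y - x)) * \<bar>u - s\<bar>"
    proof (intro exI conjI allI impI)
      \<comment> \<open>The \<open>+ 1\<close> covers the case \<open>N (y - x) = 0\<close>.\<close>
      show "\<delta> / (N (y - x) + 1) > 0" using \<delta> N_nonneg[of "y - x"] by simp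
      fix u assume "\<bar>u - s\<bar> < \<delta> / (N (y - x) + 1)"
      then have "\<bar>u - s\<bar> * (N (y - x) + 1) < \<delta>" using N_nonneg[of "y - x"] by (simp add: field_simps)
      then have "\<bar>u - s\<bar> * N (y - x) < \<delta>" by (simp add: algebra_simps)
      then have "d (p s) (p u) < \<delta>" using p[of u s] by (simp add: commute)
      then have "d (G (p s)) (G (p u)) \<le> K * d (p s) (p u)" by (rule \<delta>)
      also have "\<dots> \<le> K * (\<bar>u - s\<bar> * N (y - x))"
        using p[of u s] \<open>K \<ge> 0\<close> by (intro mult_left_mono) (auto simp: commute)
      finally show "d (G (p u)) (G (p s)) \<le> (K * N (y - x)) * \<bar>u - s\<bar>" by (simp add: commute mult_ac)
    qed
  qed simp
  moreover have "d (x, t) (y, \<sigma> 1) = N (y - x)"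
    using p[of 0 1] proj[of y x t "\<sigma> 1"] by (simp add: p01)
  ultimately show thesis using that[of "\<sigma> 1"] by (simp add: p01)
qed

text \<open>A lifted segment of length at most \<open>d p q\<close> leads from \<open>p\<close> to
  the fibre of \<open>q\<close>, and a vertical displacement of at most \<open>2 * d p q\<close>
  remains: hence 3 = 1 + 2. The vertical part has its own hypothesis, as fibres contain no
  rectifiable curves along which a local bound could be added up.\<close>

lemma fibrewise_and_locally_Lipschitz_imp_Lipschitz:
  fixes G :: "'a \<times> real \<Rightarrow> 'a \<times> real"
  assumes "K \<ge> 0"
    and fibre: "\<And>x s t. d (G (x, s)) (G (x, t)) \<le> K * d (x, s) (x, t)"
    and local: "\<And>p. \<exists>\<delta>>0. \<forall>q. d p q < \<delta> \<longrightarrow> d (G p) (G q) \<le> K * d p q"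
  shows "d (G p) (G q) \<le> 3 * K * d p q"
proof -
  obtain x t y s where pq: "p = (x, t)" "q = (y, s)" by (metis surj_pair)
  obtain r where r: "d (x, t) (y, r) = N (y - x)" "d (G (x, t)) (G (y, r)) \<le> K * N (y - x)"
    using locally_Lipschitz_along_segment[of K x y G t] assms by metis
  have N: "N (y - x) \<le> d p q" using proj by (simp add: pq)
  have "d (y, r) q \<le> 2 * d p q" using triangle[of "(y, r)" p q] r N by (simp add: pq commute)
  then have "d (G (y, r)) (G q) \<le> K * (2 * d p q)"
    using fibre[of y r s] \<open>K \<ge> 0\<close> by (simp add: pq) (meson mult_left_mono order_trans)
  moreover have "d (G p) (G (y, r)) \<le> K * d p q"
    using r N \<open>K \<ge> 0\<close> by (simp add: pq) (meson mult_left_mono order_trans)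
  ultimately show ?thesis using triangle[of "G p" "G (y, r)" "G q"] by simp
qed

end

subsection \<open>Fibre preserving quasiconformal maps\<close>

text \<open>\<open>local_wqs\<close> is the usable form of quasiconformality. Its
  \<open>\<tau>\<close> depends on \<open>p\<close> and restricts only the nearer point
  \<open>q\<close>, because the infimum in \<open>qc_ratio\<close> runs over all points at distance
  at least \<open>t\<close>.\<close>

locale fibred_qc = fibred_metric d N \<kappa>
  for d :: "'a::real_vector \<times> real \<Rightarrow> 'a \<times> real \<Rightarrow> real" and N \<kappa> +
  fixes F :: "'a \<times> real \<Rightarrow> 'a \<times> real" and f :: "'a \<Rightarrow> 'a" and \<Lambda> :: real
  assumes bij: "bij F"
    and fibre_image: "F ` ({x} \<times> UNIV) = {f x} \<times> UNIV"
    and cont: "\<epsilon> > 0 \<Longrightarrow> \<exists>\<delta>>0. \<forall>q. d p q < \<delta> \<longrightarrow> d (F p) (F q) < \<epsilon>"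
    and cont_inv: "\<epsilon> > 0 \<Longrightarrow> \<exists>\<delta>>0. \<forall>q. d p q < \<delta> \<longrightarrow> d (inv F p) (inv F q) < \<epsilon>"
    and \<Lambda>: "\<Lambda> \<ge> 1"
    and local_wqs: "\<exists>\<tau>>0. \<forall>q q'. d q p \<le> d q' p \<and> d q p < \<tau> \<longrightarrow> d (F q) (F p) \<le> \<Lambda> * d (F q') (F p)"
begin

section \<open>The height functions on the fibres\<close>

definition h :: "'a \<Rightarrow> real \<Rightarrow> real" where "h x t = snd (F (x, t))"

lemma F_eq: "F (x, t) = (f x, h x t)"
proof -
  have "F (x, t) \<in> {f x} \<times> UNIV" unfolding fibre_image[symmetric] by blast
  then show ?thesis by (auto simp: h_def prod_eq_iff)
qed

lemma fibre_onto: obtains s where "F (x, s) = (f x, t)"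
proof -
  have "(f x, t) \<in> F ` ({x} \<times> UNIV)" unfolding fibre_image by blast
  then show thesis using that by force
qed

lemma vert_F: "d (F (x, s)) (F (x, t)) = \<kappa> * sqrt \<bar>h x s - h x t\<bar>"
  by (simp add: F_eq vert)

lemma continuous_h: "continuous_on UNIV (h x)"
proof (rule continuous_at_imp_continuous_on, rule ballI)
  fix t
  show "isCont (h x) t"
    unfolding continuous_at_eps_delta
  proof (intro allI impI)
    fix \<epsilon> :: real assume "\<epsilon> > 0"
    then have "\<kappa> * sqrt \<epsilon> > 0" using \<kappa>_pos by simp
    from cont[OF this, of "(x, t)"] obtain \<delta> where
      \<delta>: "\<delta> > 0" "\<And>q. d (x, t) q < \<delta> \<Longrightarrow> d (F (x, t)) (F q) < \<kappa> * sqrt \<epsilon>" by blast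
    show "\<exists>\<delta>>0. \<forall>s. dist s t < \<delta> \<longrightarrow> dist (h x s) (h x t) < \<epsilon>"
    proof (intro exI conjI allI impI)
      show "(\<delta> / \<kappa>)\<^sup>2 > 0" using \<delta> \<kappa>_pos by simp
      fix s assume "dist s t < (\<delta> / \<kappa>)\<^sup>2"
      then have "sqrt \<bar>t - s\<bar> < \<delta> / \<kappa>"
        using \<delta>(1) \<kappa>_pos by (intro real_less_lsqrt) (auto simp: dist_real_def abs_minus_commute)
      then have "d (x, t) (x, s) < \<delta>" using \<kappa>_pos by (simp add: vert field_simps)
      from \<delta>(2)[OF this] have "sqrt \<bar>h x t - h x s\<bar> < sqrt \<epsilon>" using \<kappa>_pos by (simp add: vert_F)
      then show "dist (h x s) (h x t) < \<epsilon>" by (simp add: dist_real_def abs_minus_commute)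
    qed
  qed
qed

lemma inj_h: "inj (h x)"
proof (rule injI)
  fix s t assume "h x s = h x t"
  then have "F (x, s) = F (x, t)" by (simp add: F_eq)
  then show "s = t" using bij by (auto dest: bij_is_inj injD)
qed

lemma additive_h:
  assumes "u \<le> v" "v \<le> w"
  shows "\<bar>h x w - h x u\<bar> = \<bar>h x v - h x u\<bar> + \<bar>h x w - h x v\<bar>"
proof (cases "u < v \<and> v < w")
  case True
  have "continuous_on {u..w} (h x)" "inj_on (h x) {u..w}"
    using continuous_h inj_h by (auto intro: continuous_on_subset inj_on_subset)
  from continuous_inj_imp_mono[OF _ _ this, of v] True
  have "h x u < h x v \<and> h x v < h x w \<or> h x w < h x v \<and> h x v < h x u" by blast
  then show ?thesis by linarith
next
  case False
  then have "u = v \<or> v = w" using assms by auto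
  then show ?thesis by auto
qed

section \<open>Distortion at a uniform scale on part of each fibre\<close>

text \<open>The strict inequality \<open>d q p < d q' p\<close>, in place of the weak one in
  \<open>local_wqs\<close>, makes the premise an open condition on \<open>p\<close>. For fixed
  \<open>\<tau>\<close> the set of good heights on a fibre is then closed, as the category argument
  requires.\<close>

definition wqs :: "real \<Rightarrow> 'a \<times> real \<Rightarrow> bool" where
  "wqs \<tau> p \<longleftrightarrow> (\<forall>q q'. d q p < d q' p \<and> d q p < \<tau> \<longrightarrow> d (F q) (F p) \<le> \<Lambda> * d (F q') (F p))"

lemma wqs_mono: "wqs \<tau> p \<Longrightarrow> \<tau>' \<le> \<tau> \<Longrightarrow> wqs \<tau>' p"
  unfolding wqs_def by auto

lemma ex_wqs: "\<exists>\<tau>>0. wqs \<tau> p"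
proof -
  obtain \<tau> where "\<tau> > 0"
    "\<forall>q q'. d q p \<le> d q' p \<and> d q p < \<tau> \<longrightarrow> d (F q) (F p) \<le> \<Lambda> * d (F q') (F p)"
    using local_wqs[of p] by blast
  then show ?thesis unfolding wqs_def by (intro exI[of _ \<tau>]) auto
qed

lemma continuous_dist_fibre:
  "continuous_on UNIV (\<lambda>t. d q (x, t))" "continuous_on UNIV (\<lambda>t. d q (F (x, t)))"
proof -
  have *: "continuous_on UNIV (\<lambda>t. d q (y, k t))" if k: "continuous_on UNIV k" for y and k :: "real \<Rightarrow> real"
  proof (rule continuous_at_imp_continuous_on, rule ballI)
    fix t
    have "((\<lambda>s. d (y, k s) (y, k t)) \<longlongrightarrow> \<kappa> * sqrt \<bar>k t - k t\<bar>) (at t)"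
      unfolding vert using k
      by (intro tendsto_intros) (auto simp: continuous_on_eq_continuous_at isCont_def)
    then have "((\<lambda>s. d (y, k s) (y, k t)) \<longlongrightarrow> 0) (at t)" by simp
    moreover have "norm (d q (y, k s) - d q (y, k t)) \<le> d (y, k s) (y, k t)" for s
      using reverse_triangle[of q "(y, k s)" q "(y, k t)"] by simp
    ultimately have "((\<lambda>s. d q (y, k s) - d q (y, k t)) \<longlongrightarrow> 0) (at t)"
      by (auto intro!: Lim_null_comparison[of _ "\<lambda>s. d (y, k s) (y, k t)"])
    then show "isCont (\<lambda>t. d q (y, k t)) t" unfolding isCont_def by (simp add: LIM_zero_iff)
  qed
  show "continuous_on UNIV (\<lambda>t. d q (x, t))" using *[of "\<lambda>t. t" x] by simp
  show "continuous_on UNIV (\<lambda>t. d q (F (x, t)))" unfolding F_eq using *[OF continuous_h] .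
qed

lemma closed_wqs: "closed {t. wqs \<tau> (x, t)}"
  unfolding wqs_def
  by (intro closed_Collect_all closed_Collect_imp open_Collect_conj open_Collect_less
      closed_Collect_le continuous_intros continuous_dist_fibre)

lemma ex_uniform_wqs: obtains a b \<tau> where "a < b" "\<tau> > 0" "\<forall>t\<in>{a..b}. wqs \<tau> (x, t)"
proof -
  define A where "A n = {t. wqs (1 / real (Suc n)) (x, t)}" for n
  have cl: "closed (A n)" for n unfolding A_def by (rule closed_wqs)
  have "\<exists>n. interior (A n) \<noteq> {}"
  proof (rule ccontr)
    assume "\<not> ?thesis"
    then have e: "interior (A n) = {}" for n by auto
    \<comment> \<open>If every \<open>A n\<close> had empty interior, the complements would be dense
      open sets; yet their intersection is empty, since each height is good at some scale
      \<open>1 / real (Suc n)\<close>.\<close>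
    have "UNIV \<subseteq> closure (\<Inter> (range (\<lambda>n. - A n)))"
    proof (rule Baire)
      fix T assume "T \<in> range (\<lambda>n. - A n)"
      then obtain n where "T = - A n" by auto
      then show "openin (top_of_set UNIV) T \<and> UNIV \<subseteq> closure T"
        using cl[of n] e[of n] by (auto simp: closure_complement)
    qed auto
    moreover have "\<exists>n. t \<in> A n" for t
    proof -
      obtain \<tau> where "\<tau> > 0" "wqs \<tau> (x, t)" using ex_wqs by blast
      moreover obtain n where "1 / real (Suc n) < \<tau>" using \<open>\<tau> > 0\<close> by (meson nat_approx_posE)
      ultimately have "wqs (1 / real (Suc n)) (x, t)" by (meson wqs_mono less_imp_le)
      then show ?thesis unfolding A_def by blast
    qed
    then have "\<Inter> (range (\<lambda>n. - A n)) = {}" by auto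
    ultimately show False by simp
  qed
  then obtain n t where "t \<in> interior (A n)" by blast
  then obtain e where "e > 0" "cball t e \<subseteq> A n"
    by (meson mem_interior_cball)
  then have "t - e < t + e" "\<And>s. s \<in> {t - e..t + e} \<Longrightarrow> wqs (1 / real (Suc n)) (x, s)"
    by (auto simp: cball_def dist_real_def A_def subset_eq abs_le_iff)
  then show thesis using that[of "t - e" "t + e" "1 / real (Suc n)"] by auto
qed

text \<open>Both increments are compared with \<open>N (f y - f x)\<close>, the distance between the images of the fibres
  over \<open>x\<close> and over a point \<open>y\<close> whose distance from \<open>x\<close> lies between those of the two displacements.\<close>

lemma compare_increments:
  assumes w: "wqs \<tau> (x, t1)" "wqs \<tau> (x, t2)" and e: "\<bar>e1\<bar> < \<bar>e2\<bar>" "\<kappa> * sqrt \<bar>e1\<bar> < \<tau>"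
  shows "\<bar>h x (t1 + e1) - h x t1\<bar> \<le> \<Lambda> ^ 4 * \<bar>h x (t2 + e2) - h x t2\<bar>"
proof -
  \<comment> \<open>A distance \<open>r\<close> strictly between the two displacements makes both
    comparisons strict, as \<open>wqs\<close> demands; \<open>r < \<tau>\<close> serves the second
    one, where the point over \<open>y\<close> is the nearer point.\<close>
  have "\<kappa> * sqrt \<bar>e1\<bar> < min (\<kappa> * sqrt \<bar>e2\<bar>) \<tau>" using e \<kappa>_pos by simp
  then obtain r where r: "\<kappa> * sqrt \<bar>e1\<bar> < r" "r < \<kappa> * sqrt \<bar>e2\<bar>" "r < \<tau>"
    using dense by (metis min_less_iff_conj)
  moreover have "\<kappa> * sqrt \<bar>e1\<bar> \<ge> 0" using \<kappa>_pos by simp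
  ultimately have "r \<ge> 0" by linarith
  then obtain v where v: "N v = r" by (rule N_onto)
  define y where "y = x + v"
  have N: "N (y - x) = r" by (simp add: y_def v)
  \<comment> \<open>At \<open>t1\<close> the image of the point over \<open>y\<close> must be as
    near as possible, so the lift is taken in the target and pulled back by \<open>F\<close>. At
    \<open>t2\<close> the point itself must be as near as possible, so there the lift is taken in
    the source.\<close>
  obtain s' where s': "d (f x, h x t1) (f y, s') = N (f y - f x)" by (rule lift)
  obtain s where s: "F (y, s) = (f y, s')" by (rule fibre_onto)
  have distance: "d (F (y, s)) (F (x, t1)) = N (f y - f x)"
    using s' by (simp add: s F_eq[of x] commute)
  have "d (x, t1 + e1) (x, t1) < d (y, s) (x, t1)"
    using proj[of y x t1 s] r(1) by (simp add: N vert commute)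
  then have "d (F (x, t1 + e1)) (F (x, t1)) \<le> \<Lambda> * d (F (y, s)) (F (x, t1))"
    using w(1) e(2) unfolding wqs_def by (simp add: vert)
  then have 1: "\<kappa> * sqrt \<bar>h x (t1 + e1) - h x t1\<bar> \<le> \<Lambda> * N (f y - f x)"
    using distance by (simp add: vert_F)
  obtain s2 where s2: "d (x, t2) (y, s2) = N (y - x)" by (rule lift)
  have "d (y, s2) (x, t2) < d (x, t2 + e2) (x, t2)" "d (y, s2) (x, t2) < \<tau>"
    using s2 r by (simp_all add: N vert commute)
  then have "d (F (y, s2)) (F (x, t2)) \<le> \<Lambda> * d (F (x, t2 + e2)) (F (x, t2))"
    using w(2) unfolding wqs_def by blast
  then have "N (f y - f x) \<le> \<Lambda> * (\<kappa> * sqrt \<bar>h x (t2 + e2) - h x t2\<bar>)"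
    using proj[of "f y" "f x" "h x t2" "h y s2"] by (simp add: vert_F) (simp add: F_eq commute)
  then have "\<Lambda> * N (f y - f x) \<le> \<Lambda> * (\<Lambda> * (\<kappa> * sqrt \<bar>h x (t2 + e2) - h x t2\<bar>))"
    using \<Lambda> by (intro mult_left_mono) auto
  with 1 have "\<kappa> * sqrt \<bar>h x (t1 + e1) - h x t1\<bar> \<le> \<kappa> * (\<Lambda>\<^sup>2 * sqrt \<bar>h x (t2 + e2) - h x t2\<bar>)"
    by (simp add: power2_eq_square mult_ac)
  then have "sqrt \<bar>h x (t1 + e1) - h x t1\<bar> \<le> \<Lambda>\<^sup>2 * sqrt \<bar>h x (t2 + e2) - h x t2\<bar>"
    using \<kappa>_pos by simp
  \<comment> \<open>Heights are squares of distances, so \<open>\<Lambda>\<^sup>2\<close> turns into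
    \<open>\<Lambda> ^ 4\<close>.\<close>
  then have "(sqrt \<bar>h x (t1 + e1) - h x t1\<bar>)\<^sup>2 \<le> (\<Lambda>\<^sup>2 * sqrt \<bar>h x (t2 + e2) - h x t2\<bar>)\<^sup>2"
    by (intro power_mono) auto
  then show ?thesis by (simp add: power_mult_distrib flip: power_mult)
qed

text \<open>With \<open>M = \<Lambda> ^ 4\<close>, the partition of the good interval contributes
  \<open>4 * M\<close>, the comparison of an arbitrary base point with \<open>a\<close> another
  \<open>M\<close>, and the doubling or halving of the step that makes this comparison strict a
  factor 2: together \<open>8 * \<Lambda> ^ 8\<close>. Only \<open>A\<close> depends on the
  fibre.\<close>

lemma fibre_linear:
  "\<exists>A>0. \<forall>s t. \<bar>h x s - h x t\<bar> \<le> 8 * \<Lambda> ^ 8 * A * \<bar>s - t\<bar> \<and> A * \<bar>s - t\<bar> \<le> 8 * \<Lambda> ^ 8 * \<bar>h x s - h x t\<bar>"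
proof -
  obtain a b \<tau> where ab: "a < b" "\<tau> > 0" "\<forall>t\<in>{a..b}. wqs \<tau> (x, t)" by (rule ex_uniform_wqs[of x])
  define M where "M = \<Lambda> ^ 4"
  have M: "M \<ge> 1" using \<Lambda> by (simp add: M_def)
  have small: "\<kappa> * sqrt \<bar>e\<bar> < \<tau>" if "\<bar>e\<bar> < (\<tau> / \<kappa>)\<^sup>2" "\<tau> > 0" for e \<tau>
  proof -
    have "sqrt \<bar>e\<bar> < \<tau> / \<kappa>" using that \<kappa>_pos by (intro real_less_lsqrt) auto
    then show ?thesis using \<kappa>_pos by (simp add: field_simps)
  qed
  have compare: "\<bar>h x (t1 + e1) - h x t1\<bar> \<le> M * \<bar>h x (t2 + e2) - h x t2\<bar>"
    if "t1 \<in> {a..b}" "t2 \<in> {a..b}" "\<bar>e1\<bar> < \<bar>e2\<bar>" "\<bar>e1\<bar> < (\<tau> / \<kappa>)\<^sup>2" for t1 t2 e1 e2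
    unfolding M_def using that ab small by (intro compare_increments[of \<tau>]) auto
  have ne: "h x a \<noteq> h x b" using inj_h ab by (auto simp: inj_def)
  have pos: "(\<tau> / \<kappa>)\<^sup>2 > 0" "M > 0" using ab \<kappa>_pos M by simp_all
  obtain A \<eta> where A: "A > 0" "\<eta> > 0"
    "\<And>t e. t \<in> {a..b} \<Longrightarrow> \<bar>e\<bar> < \<eta> \<Longrightarrow> \<bar>h x (t + e) - h x t\<bar> \<le> 4 * M * A * \<bar>e\<bar>"
    "\<And>t e. t \<in> {a..b} \<Longrightarrow> \<bar>e\<bar> < \<eta> \<Longrightarrow> A * \<bar>e\<bar> \<le> 4 * M * \<bar>h x (t + e) - h x t\<bar>"
    by (rule comparable_increments_imp_linear_increments[OF additive_h ab(1) ne pos compare]) blast+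
  have local: "\<exists>\<delta>>0. \<forall>e. \<bar>e\<bar> < \<delta> \<longrightarrow> \<bar>h x (t + e) - h x t\<bar> \<le> 8 * M\<^sup>2 * A * \<bar>e\<bar>
      \<and> A * \<bar>e\<bar> \<le> 8 * M\<^sup>2 * \<bar>h x (t + e) - h x t\<bar>" for t
  proof -
    obtain \<tau>' where "\<tau>' > 0" "wqs \<tau>' (x, t)" using ex_wqs by blast
    \<comment> \<open>A scale at which both \<open>t\<close> and the good point \<open>a\<close>
      admit the comparison. It depends on \<open>t\<close>, which
      \<open>locally_linear_increments_imp_linear\<close> permits.\<close>
    define \<tau>0 where "\<tau>0 = min \<tau> \<tau>'"
    have w: "\<tau>0 > 0" "wqs \<tau>0 (x, t)" "wqs \<tau>0 (x, a)"
      using ab \<open>\<tau>' > 0\<close> wqs_mono[OF \<open>wqs \<tau>' (x, t)\<close>, of \<tau>0] wqs_mono[of \<tau> "(x, a)" \<tau>0]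
      by (auto simp: \<tau>0_def)
    show ?thesis
    proof (intro exI conjI allI impI)
      show "min ((\<tau>0 / \<kappa>)\<^sup>2) (\<eta> / 2) > 0" using w A \<kappa>_pos by simp
      fix e assume e: "\<bar>e\<bar> < min ((\<tau>0 / \<kappa>)\<^sup>2) (\<eta> / 2)"
      have "\<bar>h x (t + e) - h x t\<bar> \<le> 8 * M\<^sup>2 * A * \<bar>e\<bar> \<and> A * \<bar>e\<bar> \<le> 8 * M\<^sup>2 * \<bar>h x (t + e) - h x t\<bar>"
      proof (cases "e = 0")
        case False
        have "\<bar>h x (t + e) - h x t\<bar> \<le> M * \<bar>h x (a + 2 * e) - h x a\<bar>"
          unfolding M_def using e False w small by (intro compare_increments[of \<tau>0]) auto
        also have "\<dots> \<le> M * (4 * M * A * \<bar>2 * e\<bar>)"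
          using A(3)[of a "2 * e"] e ab M by (intro mult_left_mono) auto
        finally have 1: "\<bar>h x (t + e) - h x t\<bar> \<le> 8 * M\<^sup>2 * A * \<bar>e\<bar>"
          by (simp add: power2_eq_square abs_mult mult_ac)
        have "\<kappa> * sqrt \<bar>e / 2\<bar> < \<tau>0" using e w by (intro small) auto
        then have "\<bar>h x (a + e / 2) - h x a\<bar> \<le> M * \<bar>h x (t + e) - h x t\<bar>"
          unfolding M_def using False w by (intro compare_increments[of \<tau>0]) auto
        then have "4 * M * \<bar>h x (a + e / 2) - h x a\<bar> \<le> 4 * M * (M * \<bar>h x (t + e) - h x t\<bar>)"
          using M by (intro mult_left_mono) auto
        moreover have "A * \<bar>e / 2\<bar> \<le> 4 * M * \<bar>h x (a + e / 2) - h x a\<bar>"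
          using A(4)[of a "e / 2"] e ab by auto
        ultimately have "A * \<bar>e / 2\<bar> \<le> 4 * M * (M * \<bar>h x (t + e) - h x t\<bar>)" by linarith
        then have "A * \<bar>e\<bar> \<le> 8 * M\<^sup>2 * \<bar>h x (t + e) - h x t\<bar>"
          by (simp add: power2_eq_square abs_mult mult_ac)
        with 1 show ?thesis by blast
      qed simp
      then show "\<bar>h x (t + e) - h x t\<bar> \<le> 8 * M\<^sup>2 * A * \<bar>e\<bar>"
        "A * \<bar>e\<bar> \<le> 8 * M\<^sup>2 * \<bar>h x (t + e) - h x t\<bar>" by auto
    qed
  qed
  have "\<exists>\<delta>>0. \<forall>e. \<bar>e\<bar> < \<delta> \<longrightarrow> A / (8 * M\<^sup>2) * \<bar>e\<bar> \<le> \<bar>h x (t + e) - h x t\<bar>" for t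
  proof -
    obtain \<delta> where \<delta>: "\<delta> > 0" "\<And>e. \<bar>e\<bar> < \<delta> \<Longrightarrow> A * \<bar>e\<bar> \<le> 8 * M\<^sup>2 * \<bar>h x (t + e) - h x t\<bar>"
      using local[of t] by blast
    have "A / (8 * M\<^sup>2) * \<bar>e\<bar> \<le> \<bar>h x (t + e) - h x t\<bar>" if "\<bar>e\<bar> < \<delta>" for e
      using \<delta>(2)[OF that] M by (simp add: field_simps)
    with \<delta>(1) show ?thesis by blast
  qed
  then have "A / (8 * M\<^sup>2) * \<bar>s - t\<bar> \<le> \<bar>h x s - h x t\<bar>" for s t
    by (intro locally_linear_increments_imp_linear(2) additive_h)
  then have low: "A * \<bar>s - t\<bar> \<le> 8 * M\<^sup>2 * \<bar>h x s - h x t\<bar>" for s t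
    using M by (simp add: field_simps)
  have "\<exists>\<delta>>0. \<forall>e. \<bar>e\<bar> < \<delta> \<longrightarrow> \<bar>h x (t + e) - h x t\<bar> \<le> 8 * M\<^sup>2 * A * \<bar>e\<bar>" for t
    using local[of t] by blast
  then have up: "\<bar>h x s - h x t\<bar> \<le> 8 * M\<^sup>2 * A * \<bar>s - t\<bar>" for s t
    by (intro locally_linear_increments_imp_linear(1) additive_h)
  have "M\<^sup>2 = \<Lambda> ^ 8" by (simp add: M_def flip: power_mult)
  with A(1) low up show ?thesis by (intro exI[of _ A]) simp
qed

section \<open>The dilation factor of a fibre\<close>

text \<open>The inequalities determine \<open>A\<close> up to a factor that depends on
  \<open>\<Lambda>\<close> only, so any choice will do. The square root turns a factor for heights
  into one for distances.\<close>

definition scale :: "'a \<Rightarrow> real" where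
  "scale x = sqrt (SOME A. A > 0 \<and> (\<forall>s t. \<bar>h x s - h x t\<bar> \<le> 8 * \<Lambda> ^ 8 * A * \<bar>s - t\<bar>
     \<and> A * \<bar>s - t\<bar> \<le> 8 * \<Lambda> ^ 8 * \<bar>h x s - h x t\<bar>))"

text \<open>The square root is the constant of \<open>fibre_linear\<close> in terms of distances;
  the extra \<open>\<Lambda>\<close> pays for replacing an arbitrary displacement by a vertical one
  in \<open>local_scale\<close>.\<close>

definition C :: real where "C = \<Lambda> * sqrt (8 * \<Lambda> ^ 8)"

lemma C_ge_1: "C \<ge> 1"
proof -
  have "8 * \<Lambda> ^ 8 \<ge> 1" using one_le_power[OF \<Lambda>, of 8] by linarith
  then have "1 * 1 \<le> \<Lambda> * sqrt (8 * \<Lambda> ^ 8)" using \<Lambda> by (intro mult_mono) auto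
  then show ?thesis by (simp add: C_def)
qed

lemma scale_pos: "scale x > 0"
  and fibre_scale_sharp: "d (F (x, s)) (F (x, t)) \<le> sqrt (8 * \<Lambda> ^ 8) * scale x * d (x, s) (x, t)"
    "scale x * d (x, s) (x, t) \<le> sqrt (8 * \<Lambda> ^ 8) * d (F (x, s)) (F (x, t))"
proof -
  obtain A where A: "scale x = sqrt A" "A > 0" "\<bar>h x s - h x t\<bar> \<le> 8 * \<Lambda> ^ 8 * A * \<bar>s - t\<bar>"
    "A * \<bar>s - t\<bar> \<le> 8 * \<Lambda> ^ 8 * \<bar>h x s - h x t\<bar>" for s t
    using someI_ex[OF fibre_linear[of x]] unfolding scale_def by blast
  show "scale x > 0" using A by simp
  have "sqrt \<bar>h x s - h x t\<bar> \<le> sqrt (8 * \<Lambda> ^ 8 * A * \<bar>s - t\<bar>)" using A(3) by simp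
  then have "\<kappa> * sqrt \<bar>h x s - h x t\<bar> \<le> \<kappa> * (sqrt (8 * \<Lambda> ^ 8) * sqrt A * sqrt \<bar>s - t\<bar>)"
    using \<kappa>_pos by (simp add: real_sqrt_mult)
  then show "d (F (x, s)) (F (x, t)) \<le> sqrt (8 * \<Lambda> ^ 8) * scale x * d (x, s) (x, t)"
    by (simp only: vert_F vert A(1) mult_ac)
  have "sqrt (A * \<bar>s - t\<bar>) \<le> sqrt (8 * \<Lambda> ^ 8 * \<bar>h x s - h x t\<bar>)" using A(4) by simp
  then have "\<kappa> * (sqrt A * sqrt \<bar>s - t\<bar>) \<le> \<kappa> * (sqrt (8 * \<Lambda> ^ 8) * sqrt \<bar>h x s - h x t\<bar>)"
    using \<kappa>_pos by (simp add: real_sqrt_mult)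
  then show "scale x * d (x, s) (x, t) \<le> sqrt (8 * \<Lambda> ^ 8) * d (F (x, s)) (F (x, t))"
    by (simp only: vert_F vert A(1) mult_ac)
qed

lemma fibre_scale:
  "d (F (x, s)) (F (x, t)) \<le> C * scale x * d (x, s) (x, t)"
  "scale x * d (x, s) (x, t) \<le> C * d (F (x, s)) (F (x, t))"
proof -
  have *: "sqrt (8 * \<Lambda> ^ 8) \<le> C" unfolding C_def using \<Lambda> mult_right_mono[of 1 \<Lambda> "sqrt (8 * \<Lambda> ^ 8)"] by simp
  have "sqrt (8 * \<Lambda> ^ 8) * (scale x * d (x, s) (x, t)) \<le> C * (scale x * d (x, s) (x, t))"
    using * scale_pos[of x] by (intro mult_right_mono) auto
  with fibre_scale_sharp(1)[of x s t]
  show "d (F (x, s)) (F (x, t)) \<le> C * scale x * d (x, s) (x, t)" by (simp add: mult_ac)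
  have "sqrt (8 * \<Lambda> ^ 8) * d (F (x, s)) (F (x, t)) \<le> C * d (F (x, s)) (F (x, t))"
    using * by (intro mult_right_mono) auto
  with fibre_scale_sharp(2)[of x s t]
  show "scale x * d (x, s) (x, t) \<le> C * d (F (x, s)) (F (x, t))" by linarith
qed

text \<open>A vertical point at the same distance from \<open>(x, t)\<close> is the yardstick for
  \<open>q\<close>. The weak inequality in \<open>local_wqs\<close> lets the two be compared both
  ways, which gives the upper and the lower bound with the same \<open>scale x\<close>.\<close>

lemma local_scale:
  "\<exists>\<delta>>0. \<forall>q. d (x, t) q < \<delta> \<longrightarrow> d (F (x, t)) (F q) \<le> C * scale x * d (x, t) q \<and>
     scale x * d (x, t) q \<le> C * d (F (x, t)) (F q)"
proof -
  obtain \<tau> where \<tau>: "\<tau> > 0"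
    "\<And>q q'. d q (x, t) \<le> d q' (x, t) \<Longrightarrow> d q (x, t) < \<tau> \<Longrightarrow> d (F q) (F (x, t)) \<le> \<Lambda> * d (F q') (F (x, t))"
    using local_wqs[of "(x, t)"] by blast
  have "d (F (x, t)) (F q) \<le> C * scale x * d (x, t) q \<and> scale x * d (x, t) q \<le> C * d (F (x, t)) (F q)"
    if "d (x, t) q < \<tau>" for q
  proof -
    obtain s where s: "d (x, t) (x, s) = d (x, t) q" using vert_onto[of "d (x, t) q"] by auto
    have "d (F (x, t)) (F q) \<le> \<Lambda> * d (F (x, t)) (F (x, s))"
      using \<tau>(2)[of q "(x, s)"] s that by (simp add: commute)
    also have "\<dots> \<le> \<Lambda> * (sqrt (8 * \<Lambda> ^ 8) * scale x * d (x, t) (x, s))"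
      using \<Lambda> fibre_scale_sharp(1) by (intro mult_left_mono) auto
    finally have 1: "d (F (x, t)) (F q) \<le> C * scale x * d (x, t) q" by (simp add: s C_def mult_ac)
    have "scale x * d (x, t) (x, s) \<le> sqrt (8 * \<Lambda> ^ 8) * d (F (x, t)) (F (x, s))"
      by (rule fibre_scale_sharp)
    also have "\<dots> \<le> sqrt (8 * \<Lambda> ^ 8) * (\<Lambda> * d (F (x, t)) (F q))"
      using \<tau>(2)[of "(x, s)" q] s that \<Lambda> by (intro mult_left_mono) (auto simp: commute)
    finally show ?thesis using 1 by (simp add: s C_def mult_ac)
  qed
  with \<tau>(1) show ?thesis by blast
qed

text \<open>Two points of the fibre over \<open>x\<close> at distance 1 have neighbours over
  \<open>y\<close> at distance at least 1/2, and continuity of \<open>F\<close> at these two points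
  keeps the images of the neighbours within \<open>2 * a * C\<close> of each other. The lower fibre
  estimate over \<open>y\<close> then bounds \<open>scale y\<close>.\<close>

lemma scale_locally_bounded: "\<exists>\<eta>>0. \<forall>y. N (y - x) < \<eta> \<longrightarrow> scale y \<le> 4 * C\<^sup>2 * scale x"
proof -
  define a where "a = scale x"
  have a: "a > 0" using scale_pos by (simp add: a_def)
  have C: "C > 0" using C_ge_1 by simp
  obtain t where t: "d (x, 0) (x, t) = 1" using vert_onto[of 1] by auto
  have e: "a * C / 2 > 0" using a C by simp
  obtain \<delta>1 where \<delta>1: "\<delta>1 > 0" "\<And>q. d (x, 0) q < \<delta>1 \<Longrightarrow> d (F (x, 0)) (F q) < a * C / 2"
    using cont[OF e, of "(x, 0)"] by blast
  obtain \<delta>2 where \<delta>2: "\<delta>2 > 0" "\<And>q. d (x, t) q < \<delta>2 \<Longrightarrow> d (F (x, t)) (F q) < a * C / 2"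
    using cont[OF e, of "(x, t)"] by blast
  show ?thesis
  proof (intro exI conjI allI impI)
    show "min (min \<delta>1 \<delta>2) (1 / 4) > 0" using \<delta>1 \<delta>2 by simp
    fix y assume y: "N (y - x) < min (min \<delta>1 \<delta>2) (1 / 4)"
    obtain s1 where s1: "d (x, 0) (y, s1) = N (y - x)" by (rule lift)
    obtain s2 where s2: "d (x, t) (y, s2) = N (y - x)" by (rule lift)
    have "d (y, s1) (y, s2) \<ge> 1 / 2"
      using reverse_triangle[of "(x, 0)" "(x, t)" "(y, s1)" "(y, s2)"] s1 s2 t y by auto
    then have "scale y * (1 / 2) \<le> scale y * d (y, s1) (y, s2)"
      using scale_pos[of y] by (intro mult_left_mono) auto
    also have "\<dots> \<le> C * d (F (y, s1)) (F (y, s2))" by (rule fibre_scale)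
    also have "\<dots> \<le> C * (2 * a * C)"
    proof (rule mult_left_mono)
      have "d (F (x, 0)) (F (y, s1)) < a * C / 2" "d (F (x, t)) (F (y, s2)) < a * C / 2"
        using \<delta>1(2) \<delta>2(2) s1 s2 y by auto
      moreover have "d (F (x, 0)) (F (x, t)) \<le> C * a" using fibre_scale(1)[of x 0 t] t by (simp add: a_def)
      ultimately show "d (F (y, s1)) (F (y, s2)) \<le> 2 * a * C"
        using reverse_triangle[of "F (x, 0)" "F (x, t)" "F (y, s1)" "F (y, s2)"]
        by (auto simp: mult_ac abs_le_iff)
    qed (use C in auto)
    finally show "scale y \<le> 4 * C\<^sup>2 * scale x" by (simp add: a_def power2_eq_square mult_ac)
  qed
qed

text \<open>Compactness of the segment, by bisection. The size of \<open>K\<close> depends on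
  \<open>x\<close> and \<open>y\<close>; \<open>scale_comparable\<close> uses only that it is
  finite.\<close>

lemma scale_bounded_on_segment: "\<exists>K\<ge>0. \<forall>u\<in>{0..1}. scale (x + u *\<^sub>R (y - x)) \<le> K"
proof -
  have "\<exists>K\<ge>0. \<forall>u\<in>{a..b}. scale (x + u *\<^sub>R (y - x)) \<le> K" if "a \<le> b" for a b
    using that
  proof (induction rule: Bolzano)
    case (trans a b c)
    then obtain K K' where "K \<ge> 0" "\<forall>u\<in>{a..b}. scale (x + u *\<^sub>R (y - x)) \<le> K"
      "\<forall>u\<in>{b..c}. scale (x + u *\<^sub>R (y - x)) \<le> K'" by blast
    then show ?case by (intro exI[of _ "max K K'"]) (auto simp: le_max_iff_disj)
  next
    case (local u)
    define z where "z = x + u *\<^sub>R (y - x)"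
    obtain \<eta> where \<eta>: "\<eta> > 0" "\<And>w. N (w - z) < \<eta> \<Longrightarrow> scale w \<le> 4 * C\<^sup>2 * scale z"
      using scale_locally_bounded by blast
    define n where "n = N (y - x)"
    have n: "n \<ge> 0" using N_nonneg by (simp add: n_def)
    show ?case
    proof (intro exI conjI allI impI ballI)
      show "\<eta> / (n + 1) > 0" using \<eta> n by simp
      show "4 * C\<^sup>2 * scale z \<ge> 0" using scale_pos[of z] by simp
      fix a b v assume ab: "a \<le> u \<and> u \<le> b \<and> b - a < \<eta> / (n + 1)" and v: "v \<in> {a..b}"
      then have "\<bar>v - u\<bar> < \<eta> / (n + 1)" by auto
      then have "\<bar>v - u\<bar> * (n + 1) < \<eta>" using n by (simp add: field_simps)
      then have "\<bar>v - u\<bar> * n < \<eta>" by (simp add: algebra_simps)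
      moreover have "(x + v *\<^sub>R (y - x)) - z = (v - u) *\<^sub>R (y - x)" by (simp add: z_def algebra_simps)
      ultimately show "scale (x + v *\<^sub>R (y - x)) \<le> 4 * C\<^sup>2 * scale z"
        by (intro \<eta>) (simp only: N_scale n_def)
    qed
  qed
  from this[of 0 1] show ?thesis by simp
qed

text \<open>\<open>F\<close> moves two given fibres apart by a bounded amount, which is negligible against the distances
  along the fibres.\<close>

lemma scale_comparable: "scale y \<le> C\<^sup>2 * scale x"
proof -
  have C: "C > 0" using C_ge_1 by simp
  obtain K where K: "K \<ge> 0" "\<And>u. u \<in> {0..1} \<Longrightarrow> scale (x + u *\<^sub>R (y - x)) \<le> K"
    using scale_bounded_on_segment by blast
  have "\<exists>\<delta>>0. \<forall>q. d (x + u *\<^sub>R (y - x), t) q < \<delta> \<longrightarrow>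
      d (F (x + u *\<^sub>R (y - x), t)) (F q) \<le> C * K * d (x + u *\<^sub>R (y - x), t) q"
    if "0 \<le> u" "u \<le> 1" for u t
  proof -
    define z where "z = x + u *\<^sub>R (y - x)"
    obtain \<delta> where \<delta>: "\<delta> > 0" "\<And>q. d (z, t) q < \<delta> \<Longrightarrow> d (F (z, t)) (F q) \<le> C * scale z * d (z, t) q"
      using local_scale by blast
    have "C * scale z * d (z, t) q \<le> C * K * d (z, t) q" for q
      using K(2)[of u] that C by (intro mult_right_mono mult_left_mono) (auto simp: z_def)
    then show ?thesis using \<delta> unfolding z_def by (meson order_trans)
  qed
  note local = this
  have CK: "C * K \<ge> 0" using K C by simp
  have move: "\<exists>s. d (x, t) (y, s) = N (y - x) \<and> d (F (x, t)) (F (y, s)) \<le> C * K * N (y - x)" for t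
    using locally_Lipschitz_along_segment[where G = F, OF CK local, of t] by blast
  define n where "n = N (y - x)"
  \<comment> \<open>The bracket does not depend on \<open>r\<close>, the distance along the fibre.
    For large \<open>r\<close> it is negligible, and the coefficients of \<open>r\<close> can be
    compared.\<close>
  have bound: "scale y * r \<le> C\<^sup>2 * scale x * r + (2 * C\<^sup>2 * K * n + 2 * scale y * n)" if r: "r \<ge> 0" for r
  proof -
    obtain t where t: "d (x, 0) (x, t) = r" using vert_onto[OF r, of x 0] by blast
    obtain s1 where s1: "d (x, 0) (y, s1) = n" "d (F (x, 0)) (F (y, s1)) \<le> C * K * n"
      using move n_def by blast
    obtain s2 where s2: "d (x, t) (y, s2) = n" "d (F (x, t)) (F (y, s2)) \<le> C * K * n"
      using move n_def by blast
    have "r - 2 * n \<le> d (y, s1) (y, s2)"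
      using reverse_triangle[of "(x, 0)" "(x, t)" "(y, s1)" "(y, s2)"] s1 s2 t by auto
    then have "scale y * (r - 2 * n) \<le> scale y * d (y, s1) (y, s2)"
      using scale_pos[of y] by (intro mult_left_mono) auto
    also have "\<dots> \<le> C * d (F (y, s1)) (F (y, s2))" by (rule fibre_scale)
    also have "\<dots> \<le> C * (C * scale x * r + 2 * (C * K * n))"
    proof (rule mult_left_mono)
      show "d (F (y, s1)) (F (y, s2)) \<le> C * scale x * r + 2 * (C * K * n)"
        using reverse_triangle[of "F (x, 0)" "F (x, t)" "F (y, s1)" "F (y, s2)"] s1 s2
          fibre_scale(1)[of x 0 t] t
        by auto
    qed (use C in auto)
    finally show ?thesis by (simp add: power2_eq_square algebra_simps)
  qed
  show ?thesis
  proof (rule ccontr)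
    assume "\<not> ?thesis"
    then have D: "scale y - C\<^sup>2 * scale x > 0" by simp
    define B where "B = 2 * C\<^sup>2 * K * n + 2 * scale y * n"
    have "n \<ge> 0" using N_nonneg by (simp add: n_def)
    then have "B \<ge> 0" using K scale_pos[of y] by (simp add: B_def)
    define r where "r = (B + 1) / (scale y - C\<^sup>2 * scale x)"
    have "r \<ge> 0" using \<open>B \<ge> 0\<close> D by (simp add: r_def)
    then have "scale y * r \<le> C\<^sup>2 * scale x * r + B" using bound[of r] by (simp add: B_def)
    then have "(scale y - C\<^sup>2 * scale x) * r \<le> B" by (simp add: algebra_simps)
    moreover have "(scale y - C\<^sup>2 * scale x) * r = B + 1" using D by (simp add: r_def)
    ultimately show False by simp
  qed
qed

text \<open>\<open>K\<close> and \<open>K'\<close> come from comparing every factor with that of the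
  fibre over 0, from above and from below. Upper bounds for \<open>inv F\<close> are lower bounds
  for \<open>F\<close> read backwards.\<close>

theorem biLipschitz_of_fibred_qc:
  obtains L where "L \<ge> 1" "\<And>p q. d p q / L \<le> d (F p) (F q)" "\<And>p q. d (F p) (F q) \<le> L * d p q"
proof -
  have C: "C > 0" using C_ge_1 by simp
  define a where "a = scale 0"
  have a: "a > 0" using scale_pos by (simp add: a_def)
  define K where "K = C * (C\<^sup>2 * a)"
  define K' where "K' = C * (C\<^sup>2 / a)"
  have up: "C * scale x \<le> K" for x
    using scale_comparable[of x 0] C by (simp add: K_def a_def)
  have low: "C \<le> K' * scale x" for x
    using scale_comparable[of 0 x] C a by (simp add: K'_def a_def field_simps)
  have K: "K \<ge> 0" "K' \<ge> 0" using C a by (auto simp: K_def K'_def)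
  have 1: "d (F p) (F q) \<le> 3 * K * d p q" for p q
  proof (rule fibrewise_and_locally_Lipschitz_imp_Lipschitz)
    show "K \<ge> 0" by (rule K)
    show "d (F (x, s)) (F (x, t)) \<le> K * d (x, s) (x, t)" for x s t
      using fibre_scale(1)[of x s t] mult_right_mono[OF up[of x], of "d (x, s) (x, t)"] by simp
    fix p :: "'a \<times> real"
    obtain x t where p: "p = (x, t)" by fastforce
    have "C * scale x * d p q \<le> K * d p q" for q
      using up by (intro mult_right_mono) auto
    then show "\<exists>\<delta>>0. \<forall>q. d p q < \<delta> \<longrightarrow> d (F p) (F q) \<le> K * d p q"
      using local_scale[of x t] unfolding p by (meson order_trans)
  qed
  have inv: "inv F (F p) = p" "F (inv F p) = p" for p
    using bij by (auto simp: bij_def inv_f_f surj_f_inv_f)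
  \<comment> \<open>Turns a lower estimate for \<open>F\<close>, which contains
    \<open>scale x\<close>, into an upper estimate for the inverse with one constant for all
    fibres.\<close>
  have expand: "d p q \<le> K' * d p' q'" if "scale x * d p q \<le> C * d p' q'" for x p q p' q'
  proof -
    have "C * d p' q' \<le> K' * scale x * d p' q'" using low by (intro mult_right_mono) auto
    with that have "scale x * d p q \<le> scale x * (K' * d p' q')" by (simp add: mult_ac)
    then show ?thesis using scale_pos[of x] by simp
  qed
  have 2: "d (inv F p) (inv F q) \<le> 3 * K' * d p q" for p q
  proof (rule fibrewise_and_locally_Lipschitz_imp_Lipschitz)
    show "K' \<ge> 0" by (rule K)
    show "d (inv F (x', s')) (inv F (x', t')) \<le> K' * d (x', s') (x', t')" for x' s' t'
    proof -
      obtain x s where xs: "inv F (x', s') = (x, s)" by fastforce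
      then have "F (x, s) = (x', s')" by (metis inv(2))
      then have fx: "f x = x'" by (simp add: F_eq)
      obtain t where t: "F (x, t) = (f x, t')" by (rule fibre_onto)
      have "inv F (x', t') = (x, t)" by (metis t fx inv(1))
      then show ?thesis using expand[OF fibre_scale(2)[of x s t]] xs t \<open>F (x, s) = (x', s')\<close> fx by simp
    qed
    fix p
    obtain x t where p: "inv F p = (x, t)" by fastforce
    then have Fx: "F (x, t) = p" by (metis inv(2))
    obtain \<delta> where \<delta>: "\<delta> > 0" "\<And>q. d (x, t) q < \<delta> \<Longrightarrow> scale x * d (x, t) q \<le> C * d (F (x, t)) (F q)"
      using local_scale[of x t] by blast
    \<comment> \<open>The local lower bound speaks of points near \<open>(x, t)\<close>; continuity
      of the inverse puts \<open>inv F q\<close> there when \<open>q\<close> is near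
      \<open>p\<close>.\<close>
    obtain \<delta>' where \<delta>': "\<delta>' > 0" "\<And>q. d p q < \<delta>' \<Longrightarrow> d (inv F p) (inv F q) < \<delta>"
      using cont_inv[OF \<delta>(1), of p] by blast
    have "d (inv F p) (inv F q) \<le> K' * d p q" if "d p q < \<delta>'" for q
      using expand[OF \<delta>(2), of "inv F q"] \<delta>'(2)[OF that] by (simp add: p Fx inv)
    with \<delta>'(1) show "\<exists>\<delta>>0. \<forall>q. d p q < \<delta> \<longrightarrow> d (inv F p) (inv F q) \<le> K' * d p q" by blast
  qed
  define L where "L = 1 + 3 * K + 3 * K'"
  show thesis
  proof
    show "L \<ge> 1" using K by (simp add: L_def)
    have "3 * K' * d (F p) (F q) \<le> L * d (F p) (F q)" for p q
      using K by (intro mult_right_mono) (auto simp: L_def)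
    with 2[of "F p" "F q" for p q] have "d p q \<le> L * d (F p) (F q)" for p q
      by (metis inv(1) order_trans)
    then show "d p q / L \<le> d (F p) (F q)" for p q
      using \<open>L \<ge> 1\<close> by (simp add: field_simps)
    have "3 * K * d p q \<le> L * d p q" for p q
      using K by (intro mult_right_mono) (auto simp: L_def)
    with 1 show "d (F p) (F q) \<le> L * d p q" for p q by (meson order_trans)
  qed
qed

end

subsection \<open>Absolutely continuous curves\<close>

lemma abs_continuous_curve_onD:
  assumes "abs_continuous_curve_on a b \<gamma>" "\<epsilon> > 0"
  obtains \<delta> where "\<delta> > 0" "\<And>\<D>. \<D> division_of \<Union>\<D> \<Longrightarrow> \<Union>\<D> \<subseteq> {a..b} \<Longrightarrow>
    (\<Sum>K\<in>\<D>. Sup K - Inf K) < \<delta> \<Longrightarrow> (\<Sum>K\<in>\<D>. norm (\<gamma> (Sup K) - \<gamma> (Inf K))) < \<epsilon>"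
proof -
  obtain \<delta> where \<delta>: "\<delta> > 0" "\<forall>\<D>. \<D> division_of \<Union>\<D> \<and> \<Union>\<D> \<subseteq> {a..b} \<and> (\<Sum>K\<in>\<D>. Sup K - Inf K) < \<delta>
      \<longrightarrow> (\<Sum>K\<in>\<D>. norm (\<gamma> (Sup K) - \<gamma> (Inf K))) < \<epsilon>"
    using assms unfolding abs_continuous_curve_on_def by auto
  show thesis by (rule that[OF \<delta>(1)]) (use \<delta>(2) in simp)
qed

lemma division_of_real_member:
  fixes \<D> :: "real set set"
  assumes "\<D> division_of S" "K \<in> \<D>"
  shows "Inf K \<le> Sup K" "K = {Inf K..Sup K}" "Inf K \<in> K" "Sup K \<in> K"
    "measure lborel K = Sup K - Inf K" "measure lebesgue K = Sup K - Inf K"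
proof -
  obtain u v where "K = cbox u v" "K \<noteq> {}" using division_ofD(3,4)[OF assms] by blast
  then have "u \<le> v" "K = {u..v}" by auto
  then show "Inf K \<le> Sup K" "K = {Inf K..Sup K}" "Inf K \<in> K" "Sup K \<in> K"
    "measure lborel K = Sup K - Inf K" "measure lebesgue K = Sup K - Inf K" by simp_all
qed

lemma abs_continuous_curve_on_subset:
  assumes "abs_continuous_curve_on a b \<gamma>" "{c..d} \<subseteq> {a..b}"
  shows "abs_continuous_curve_on c d \<gamma>"
  unfolding abs_continuous_curve_on_def
proof (intro allI impI)
  fix \<epsilon> :: real assume "\<epsilon> > 0"
  show "\<exists>\<delta>>0. \<forall>\<D>. \<D> division_of \<Union>\<D> \<and> \<Union>\<D> \<subseteq> {c..d} \<and> (\<Sum>K\<in>\<D>. Sup K - Inf K) < \<delta>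
      \<longrightarrow> (\<Sum>K\<in>\<D>. norm (\<gamma> (Sup K) - \<gamma> (Inf K))) < \<epsilon>"
  proof (rule abs_continuous_curve_onD[OF assms(1) \<open>\<epsilon> > 0\<close>], intro exI conjI allI impI)
    fix \<delta> :: real and \<D>
    assume "\<delta> > 0"
      and \<delta>: "\<And>\<D>. \<D> division_of \<Union>\<D> \<Longrightarrow> \<Union>\<D> \<subseteq> {a..b} \<Longrightarrow>
        (\<Sum>K\<in>\<D>. Sup K - Inf K) < \<delta> \<Longrightarrow> (\<Sum>K\<in>\<D>. norm (\<gamma> (Sup K) - \<gamma> (Inf K))) < \<epsilon>"
      and \<D>: "\<D> division_of \<Union>\<D> \<and> \<Union>\<D> \<subseteq> {c..d} \<and> (\<Sum>K\<in>\<D>. Sup K - Inf K) < \<delta>"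
    then show "(\<Sum>K\<in>\<D>. norm (\<gamma> (Sup K) - \<gamma> (Inf K))) < \<epsilon>"
      using assms(2) by (intro \<delta>) (auto simp: subset_iff)
  qed
qed

text \<open>Comparing increments, and on \<open>{a..b}\<close> only, serves affine images of a
  curve, Lipschitz curves (with the identity as \<open>\<gamma>\<close>), and the exchange of a
  curve for one that agrees with it on the interval.\<close>

lemma abs_continuous_curve_on_Lipschitz_image:
  assumes "abs_continuous_curve_on a b \<gamma>"
    and L: "\<And>s t. s \<in> {a..b} \<Longrightarrow> t \<in> {a..b} \<Longrightarrow> norm (\<beta> s - \<beta> t) \<le> L * norm (\<gamma> s - \<gamma> t)"
  shows "abs_continuous_curve_on a b \<beta>"
  unfolding abs_continuous_curve_on_def
proof (intro allI impI)
  fix \<epsilon> :: real assume "\<epsilon> > 0"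
  define L' where "L' = max L 1"
  have "\<epsilon> / L' > 0" using \<open>\<epsilon> > 0\<close> by (simp add: L'_def)
  then obtain \<delta> where \<delta>: "\<delta> > 0" "\<And>\<D>. \<D> division_of \<Union>\<D> \<Longrightarrow> \<Union>\<D> \<subseteq> {a..b} \<Longrightarrow>
    (\<Sum>K\<in>\<D>. Sup K - Inf K) < \<delta> \<Longrightarrow> (\<Sum>K\<in>\<D>. norm (\<gamma> (Sup K) - \<gamma> (Inf K))) < \<epsilon> / L'"
    by (rule abs_continuous_curve_onD[OF assms(1)]) blast
  show "\<exists>\<delta>>0. \<forall>\<D>. \<D> division_of \<Union>\<D> \<and> \<Union>\<D> \<subseteq> {a..b} \<and> (\<Sum>K\<in>\<D>. Sup K - Inf K) < \<delta>
      \<longrightarrow> (\<Sum>K\<in>\<D>. norm (\<beta> (Sup K) - \<beta> (Inf K))) < \<epsilon>"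
  proof (intro exI conjI allI impI)
    show "\<delta> > 0" by fact
    fix \<D> assume \<D>: "\<D> division_of \<Union>\<D> \<and> \<Union>\<D> \<subseteq> {a..b} \<and> (\<Sum>K\<in>\<D>. Sup K - Inf K) < \<delta>"
    have "(\<Sum>K\<in>\<D>. norm (\<beta> (Sup K) - \<beta> (Inf K))) \<le> (\<Sum>K\<in>\<D>. L' * norm (\<gamma> (Sup K) - \<gamma> (Inf K)))"
    proof (rule sum_mono)
      fix K assume K: "K \<in> \<D>"
      then have "Sup K \<in> {a..b}" "Inf K \<in> {a..b}"
        using \<D> division_of_real_member(3,4)[of \<D> "\<Union>\<D>" K] by blast+
      then have "norm (\<beta> (Sup K) - \<beta> (Inf K)) \<le> L * norm (\<gamma> (Sup K) - \<gamma> (Inf K))" by (rule L)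
      also have "\<dots> \<le> L' * norm (\<gamma> (Sup K) - \<gamma> (Inf K))"
        by (intro mult_right_mono) (auto simp: L'_def)
      finally show "norm (\<beta> (Sup K) - \<beta> (Inf K)) \<le> L' * norm (\<gamma> (Sup K) - \<gamma> (Inf K))" .
    qed
    also have "\<dots> = L' * (\<Sum>K\<in>\<D>. norm (\<gamma> (Sup K) - \<gamma> (Inf K)))" by (simp add: sum_distrib_left)
    also have "\<dots> < L' * (\<epsilon> / L')" using \<delta>(2)[of \<D>] \<D> by (intro mult_strict_left_mono) (auto simp: L'_def)
    also have "\<dots> = \<epsilon>" by (simp add: L'_def)
    finally show "(\<Sum>K\<in>\<D>. norm (\<beta> (Sup K) - \<beta> (Inf K))) < \<epsilon>" .
  qed
qed

lemma abs_continuous_curve_on_id: "abs_continuous_curve_on a b (\<lambda>t::real. t)"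
  unfolding abs_continuous_curve_on_def
proof (intro allI impI)
  fix \<epsilon> :: real assume "\<epsilon> > 0"
  show "\<exists>\<delta>>0. \<forall>\<D>. \<D> division_of \<Union>\<D> \<and> \<Union>\<D> \<subseteq> {a..b} \<and> (\<Sum>K\<in>\<D>. Sup K - Inf K) < \<delta>
      \<longrightarrow> (\<Sum>K\<in>\<D>. norm (Sup K - Inf K)) < \<epsilon>"
  proof (intro exI[of _ \<epsilon>] conjI allI impI \<open>\<epsilon> > 0\<close>)
    fix \<D> :: "real set set" assume \<D>: "\<D> division_of \<Union>\<D> \<and> \<Union>\<D> \<subseteq> {a..b} \<and> (\<Sum>K\<in>\<D>. Sup K - Inf K) < \<epsilon>"
    have "(\<Sum>K\<in>\<D>. norm (Sup K - Inf K)) = (\<Sum>K\<in>\<D>. Sup K - Inf K)"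
      using \<D> division_of_real_member(1)[of \<D> "\<Union>\<D>"] by (intro sum.cong) auto
    then show "(\<Sum>K\<in>\<D>. norm (Sup K - Inf K)) < \<epsilon>" using \<D> by simp
  qed
qed

lemma abs_continuous_curve_on_add:
  assumes "abs_continuous_curve_on a b \<gamma>" "abs_continuous_curve_on a b \<beta>"
  shows "abs_continuous_curve_on a b (\<lambda>t. \<gamma> t + \<beta> t)"
  unfolding abs_continuous_curve_on_def
proof (intro allI impI)
  fix \<epsilon> :: real assume "\<epsilon> > 0"
  then have "\<epsilon> / 2 > 0" by simp
  obtain \<delta>1 where \<delta>1: "\<delta>1 > 0" "\<And>\<D>. \<D> division_of \<Union>\<D> \<Longrightarrow> \<Union>\<D> \<subseteq> {a..b} \<Longrightarrow>
    (\<Sum>K\<in>\<D>. Sup K - Inf K) < \<delta>1 \<Longrightarrow> (\<Sum>K\<in>\<D>. norm (\<gamma> (Sup K) - \<gamma> (Inf K))) < \<epsilon> / 2"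
    by (rule abs_continuous_curve_onD[OF assms(1) \<open>\<epsilon> / 2 > 0\<close>]) blast
  obtain \<delta>2 where \<delta>2: "\<delta>2 > 0" "\<And>\<D>. \<D> division_of \<Union>\<D> \<Longrightarrow> \<Union>\<D> \<subseteq> {a..b} \<Longrightarrow>
    (\<Sum>K\<in>\<D>. Sup K - Inf K) < \<delta>2 \<Longrightarrow> (\<Sum>K\<in>\<D>. norm (\<beta> (Sup K) - \<beta> (Inf K))) < \<epsilon> / 2"
    by (rule abs_continuous_curve_onD[OF assms(2) \<open>\<epsilon> / 2 > 0\<close>]) blast
  show "\<exists>\<delta>>0. \<forall>\<D>. \<D> division_of \<Union>\<D> \<and> \<Union>\<D> \<subseteq> {a..b} \<and> (\<Sum>K\<in>\<D>. Sup K - Inf K) < \<delta>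
      \<longrightarrow> (\<Sum>K\<in>\<D>. norm (\<gamma> (Sup K) + \<beta> (Sup K) - (\<gamma> (Inf K) + \<beta> (Inf K)))) < \<epsilon>"
  proof (intro exI conjI allI impI)
    show "min \<delta>1 \<delta>2 > 0" using \<delta>1 \<delta>2 by simp
    fix \<D> assume \<D>: "\<D> division_of \<Union>\<D> \<and> \<Union>\<D> \<subseteq> {a..b} \<and> (\<Sum>K\<in>\<D>. Sup K - Inf K) < min \<delta>1 \<delta>2"
    have "(\<Sum>K\<in>\<D>. norm (\<gamma> (Sup K) + \<beta> (Sup K) - (\<gamma> (Inf K) + \<beta> (Inf K))))
      \<le> (\<Sum>K\<in>\<D>. norm (\<gamma> (Sup K) - \<gamma> (Inf K)) + norm (\<beta> (Sup K) - \<beta> (Inf K)))"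
      by (intro sum_mono norm_diff_triangle_ineq)
    also have "\<dots> < \<epsilon>" using \<delta>1(2)[of \<D>] \<delta>2(2)[of \<D>] \<D> by (simp add: sum.distrib)
    finally show "(\<Sum>K\<in>\<D>. norm (\<gamma> (Sup K) + \<beta> (Sup K) - (\<gamma> (Inf K) + \<beta> (Inf K)))) < \<epsilon>" .
  qed
qed

text \<open>A monotone map sends nonoverlapping intervals to nonoverlapping ones and multiplies the
  total length by at most \<open>L\<close>. Decreasing maps reverse curves; maps with constant
  stretches are the truncations in \<open>abs_continuous_curve_on_join\<close>.\<close>

lemma abs_continuous_curve_on_reparametrize:
  fixes \<phi> :: "real \<Rightarrow> real"
  assumes ac: "abs_continuous_curve_on a b \<gamma>"
    and into: "\<And>t. t \<in> {c..d} \<Longrightarrow> \<phi> t \<in> {a..b}"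
    and lip: "\<And>s t. \<bar>\<phi> s - \<phi> t\<bar> \<le> L * \<bar>s - t\<bar>"
    and mono: "mono \<phi> \<or> antimono \<phi>"
  shows "abs_continuous_curve_on c d (\<lambda>t. \<gamma> (\<phi> t))"
  unfolding abs_continuous_curve_on_def
proof (intro allI impI)
  fix \<epsilon> :: real assume "\<epsilon> > 0"
  then obtain \<delta> where \<delta>: "\<delta> > 0" "\<And>\<D>. \<D> division_of \<Union>\<D> \<Longrightarrow> \<Union>\<D> \<subseteq> {a..b} \<Longrightarrow>
    (\<Sum>K\<in>\<D>. Sup K - Inf K) < \<delta> \<Longrightarrow> (\<Sum>K\<in>\<D>. norm (\<gamma> (Sup K) - \<gamma> (Inf K))) < \<epsilon>"
    by (rule abs_continuous_curve_onD[OF ac]) blast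
  define L' where "L' = max L 1"
  have L': "L' \<ge> 1" "\<bar>\<phi> s - \<phi> t\<bar> \<le> L' * \<bar>s - t\<bar>" for s t
  proof -
    show "L' \<ge> 1" by (simp add: L'_def)
    have "L * \<bar>s - t\<bar> \<le> L' * \<bar>s - t\<bar>" by (intro mult_right_mono) (auto simp: L'_def)
    with lip[of s t] show "\<bar>\<phi> s - \<phi> t\<bar> \<le> L' * \<bar>s - t\<bar>" by linarith
  qed
  show "\<exists>\<delta>>0. \<forall>\<D>. \<D> division_of \<Union>\<D> \<and> \<Union>\<D> \<subseteq> {c..d} \<and> (\<Sum>K\<in>\<D>. Sup K - Inf K) < \<delta>
      \<longrightarrow> (\<Sum>K\<in>\<D>. norm (\<gamma> (\<phi> (Sup K)) - \<gamma> (\<phi> (Inf K)))) < \<epsilon>"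
  proof (intro exI conjI allI impI)
    show "\<delta> / L' > 0" using \<delta> L' by simp
    fix \<D> :: "real set set"
    assume \<D>: "\<D> division_of \<Union>\<D> \<and> \<Union>\<D> \<subseteq> {c..d} \<and> (\<Sum>K\<in>\<D>. Sup K - Inf K) < \<delta> / L'"
    then have div: "\<D> division_of \<Union>\<D>" and sub: "\<Union>\<D> \<subseteq> {c..d}" by auto
    note fin = division_of_finite[OF div]
    note mem = division_of_real_member[OF div]
    define q where "q K = {min (\<phi> (Inf K)) (\<phi> (Sup K))..max (\<phi> (Inf K)) (\<phi> (Sup K))}" for K
    \<comment> \<open>Intervals with equal end values contribute nothing and could share their
      image. Without them \<open>q\<close> is injective and the images form a division.\<close>
    define \<D>0 where "\<D>0 = {K \<in> \<D>. \<phi> (Inf K) \<noteq> \<phi> (Sup K)}"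
    have fin0: "finite \<D>0" using fin by (simp add: \<D>0_def)
    have disj: "interior (q K) \<inter> interior (q K') = {}" if KK': "K \<in> \<D>0" "K' \<in> \<D>0" "K \<noteq> K'" for K K'
    proof -
      have in_D: "K \<in> \<D>" "K' \<in> \<D>" using KK' by (auto simp: \<D>0_def)
      have ne: "Inf K \<noteq> Sup K" "Inf K' \<noteq> Sup K'" using KK' by (auto simp: \<D>0_def)
      have "interior {Inf K..Sup K} \<inter> interior {Inf K'..Sup K'} = {}"
        using division_ofD(5)[OF div in_D KK'(3)] mem(2)[OF in_D(1)] mem(2)[OF in_D(2)] by simp
      then have "{max (Inf K) (Inf K')<..<min (Sup K) (Sup K')} = {}" by auto
      then have "Sup K \<le> Inf K' \<or> Sup K' \<le> Inf K"
        using ne mem(1)[OF in_D(1)] mem(1)[OF in_D(2)] by auto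
      moreover have "Inf K \<le> Sup K" "Inf K' \<le> Sup K'" using mem(1) in_D by auto
      \<comment> \<open>Two orders of the intervals and two directions of \<open>\<phi>\<close> give
        four cases.\<close>
      ultimately have "\<phi> (Inf K) \<le> \<phi> (Sup K) \<and> \<phi> (Sup K) \<le> \<phi> (Inf K') \<and> \<phi> (Inf K') \<le> \<phi> (Sup K') \<or>
          \<phi> (Inf K') \<le> \<phi> (Sup K') \<and> \<phi> (Sup K') \<le> \<phi> (Inf K) \<and> \<phi> (Inf K) \<le> \<phi> (Sup K) \<or>
          \<phi> (Sup K) \<le> \<phi> (Inf K) \<and> \<phi> (Inf K') \<le> \<phi> (Sup K) \<and> \<phi> (Sup K') \<le> \<phi> (Inf K') \<or>
          \<phi> (Sup K') \<le> \<phi> (Inf K') \<and> \<phi> (Inf K) \<le> \<phi> (Sup K') \<and> \<phi> (Sup K) \<le> \<phi> (Inf K)"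
        using mono by (auto simp: mono_def antimono_def)
      then show ?thesis
        unfolding q_def interior_atLeastAtMost_real by (elim disjE) (auto simp: min_def max_def)
    qed
    have q_ne: "q K \<noteq> {}" "interior (q K) \<noteq> {}" if "K \<in> \<D>0" for K
      using that by (auto simp: q_def \<D>0_def interior_atLeastAtMost_real)
    have inj: "inj_on q \<D>0"
    proof (rule inj_onI, rule ccontr)
      fix K K' assume "K \<in> \<D>0" "K' \<in> \<D>0" "q K = q K'" "K \<noteq> K'"
      with disj[of K K'] q_ne(2)[of K] show False by simp
    qed
    have q_SI: "Sup (q K) = max (\<phi> (Inf K)) (\<phi> (Sup K))" "Inf (q K) = min (\<phi> (Inf K)) (\<phi> (Sup K))" for K
      by (auto simp: q_def)
    have "(\<Sum>K\<in>\<D>. norm (\<gamma> (\<phi> (Sup K)) - \<gamma> (\<phi> (Inf K)))) = (\<Sum>K\<in>\<D>0. norm (\<gamma> (\<phi> (Sup K)) - \<gamma> (\<phi> (Inf K))))"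
      using fin by (intro sum.mono_neutral_right) (auto simp: \<D>0_def)
    also have "\<dots> = (\<Sum>K\<in>\<D>0. norm (\<gamma> (Sup (q K)) - \<gamma> (Inf (q K))))"
      by (intro sum.cong) (auto simp: q_SI max_def min_def norm_minus_commute)
    also have "\<dots> = (\<Sum>K\<in>q ` \<D>0. norm (\<gamma> (Sup K) - \<gamma> (Inf K)))"
      by (simp add: sum.reindex[OF inj] o_def)
    also have "\<dots> < \<epsilon>"
    proof (rule \<delta>(2))
      show "q ` \<D>0 division_of \<Union> (q ` \<D>0)"
      proof (rule division_ofI)
        show "finite (q ` \<D>0)" using fin0 by simp
        show "\<exists>a b. K = cbox a b" if "K \<in> q ` \<D>0" for K using that by (auto simp: q_def)
        show "K \<noteq> {}" if "K \<in> q ` \<D>0" for K using that q_ne by auto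
        show "interior K1 \<inter> interior K2 = {}" if "K1 \<in> q ` \<D>0" "K2 \<in> q ` \<D>0" "K1 \<noteq> K2" for K1 K2
          using that disj by blast
      qed auto
      have "q K \<subseteq> {a..b}" if "K \<in> \<D>0" for K
      proof -
        have "K \<in> \<D>" using that by (simp add: \<D>0_def)
        then have "Sup K \<in> {c..d}" "Inf K \<in> {c..d}" using mem(3,4)[of K] sub by blast+
        then have "\<phi> (Sup K) \<in> {a..b}" "\<phi> (Inf K) \<in> {a..b}" using into by blast+
        then show ?thesis by (auto simp: q_def min_def max_def split: if_splits)
      qed
      then show "\<Union> (q ` \<D>0) \<subseteq> {a..b}" by blast
      have "(\<Sum>K\<in>q ` \<D>0. Sup K - Inf K) = (\<Sum>K\<in>\<D>0. Sup (q K) - Inf (q K))"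
        by (simp add: sum.reindex[OF inj] o_def)
      also have "\<dots> = (\<Sum>K\<in>\<D>0. \<bar>\<phi> (Sup K) - \<phi> (Inf K)\<bar>)"
        by (intro sum.cong) (auto simp: q_SI max_def min_def)
      also have "\<dots> \<le> (\<Sum>K\<in>\<D>. \<bar>\<phi> (Sup K) - \<phi> (Inf K)\<bar>)"
        using fin by (intro sum_mono2) (auto simp: \<D>0_def)
      also have "\<dots> \<le> (\<Sum>K\<in>\<D>. L' * (Sup K - Inf K))"
      proof (rule sum_mono)
        fix K assume "K \<in> \<D>"
        then show "\<bar>\<phi> (Sup K) - \<phi> (Inf K)\<bar> \<le> L' * (Sup K - Inf K)"
          using L'(2)[of "Sup K" "Inf K"] mem(1)[of K] by simp
      qed
      also have "\<dots> = L' * (\<Sum>K\<in>\<D>. Sup K - Inf K)" by (simp add: sum_distrib_left)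
      also have "\<dots> < \<delta>" using \<D> L'(1) by (simp add: field_simps)
      finally show "(\<Sum>K\<in>q ` \<D>0. Sup K - Inf K) < \<delta>" .
    qed
    finally show "(\<Sum>K\<in>\<D>. norm (\<gamma> (\<phi> (Sup K)) - \<gamma> (\<phi> (Inf K)))) < \<epsilon>" .
  qed
qed

text \<open>The curve frozen outside \<open>{a..b}\<close> plus the curve frozen outside
  \<open>{b..c}\<close> is \<open>\<gamma>\<close> up to the constant \<open>\<gamma> b\<close>.
  This avoids cutting the intervals of a division at \<open>b\<close>.\<close>

lemma abs_continuous_curve_on_join:
  assumes "abs_continuous_curve_on a b \<gamma>" "abs_continuous_curve_on b c \<gamma>" "a \<le> b" "b \<le> c"
  shows "abs_continuous_curve_on a c \<gamma>"
proof -
  have "abs_continuous_curve_on a c (\<lambda>t. \<gamma> (min b (max a t)))"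
    using assms by (intro abs_continuous_curve_on_reparametrize[OF assms(1), where L = 1])
      (auto simp: mono_def min_def max_def)
  moreover have "abs_continuous_curve_on a c (\<lambda>t. \<gamma> (min c (max b t)))"
    using assms by (intro abs_continuous_curve_on_reparametrize[OF assms(2), where L = 1])
      (auto simp: mono_def min_def max_def)
  ultimately have "abs_continuous_curve_on a c (\<lambda>t. \<gamma> (min b (max a t)) + \<gamma> (min c (max b t)))"
    by (rule abs_continuous_curve_on_add)
  then show ?thesis
  proof (rule abs_continuous_curve_on_Lipschitz_image[where L = 1])
    have *: "\<gamma> (min b (max a t)) + \<gamma> (min c (max b t)) = \<gamma> t + \<gamma> b" if "t \<in> {a..c}" for t
      using that assms(3,4) by (cases "t \<le> b") (simp_all add: min_def max_def)
    show "norm (\<gamma> s - \<gamma> t) \<le> 1 * norm (\<gamma> (min b (max a s)) + \<gamma> (min c (max b s)) -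
        (\<gamma> (min b (max a t)) + \<gamma> (min c (max b t))))" if "s \<in> {a..c}" "t \<in> {a..c}" for s t
      unfolding *[OF that(1)] *[OF that(2)] by simp
  qed
qed

section \<open>The fundamental theorem of calculus for absolutely continuous curves\<close>

lemma open_cover_of_negligible:
  assumes "negligible S" "e > 0"
  obtains T where "open T" "S \<subseteq> T" "T \<in> lmeasurable" "measure lebesgue T < e"
proof -
  have "S \<in> sets lebesgue" using assms by (simp add: negligible_imp_sets)
  from sets_lebesgue_outer_open[OF this assms(2)] obtain T where
    T: "open T" "S \<subseteq> T" "(T - S) \<in> lmeasurable" "emeasure lebesgue (T - S) < ennreal e" by blast
  have S: "S \<in> lmeasurable" "measure lebesgue S = 0"
    using assms by (auto simp: negligible_imp_measurable negligible_imp_measure0)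
  have eq: "T = (T - S) \<union> S" using T by blast
  have "(T - S) \<union> S \<in> lmeasurable" using T(3) S(1) by (rule fmeasurable.Un)
  then have Tm: "T \<in> lmeasurable" using eq by simp
  have "measure lebesgue ((T - S) \<union> S) \<le> measure lebesgue (T - S) + measure lebesgue S"
    using T(3) S(1) by (intro measure_Un_le) (auto dest: fmeasurableD)
  also have "\<dots> < e" using T(3,4) \<open>e > 0\<close> S(2) by (simp add: emeasure_eq_measure2 ennreal_less_iff)
  finally have "measure lebesgue T < e" using eq by simp
  with T(1,2) Tm show thesis by (rule that)
qed

text \<open>The gauge confines the intervals tagged in the exceptional set to an open set of small measure,
  where absolute continuity bounds the increments of \<open>\<gamma>\<close>.\<close>

lemma abs_continuous_has_integral:
  fixes \<gamma> :: "real \<Rightarrow> 'a::banach"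
  assumes ac: "abs_continuous_curve_on a b \<gamma>" and "a \<le> b" and S: "negligible S"
    and der: "\<And>t. t \<in> {a..b} - S \<Longrightarrow> (\<gamma> has_vector_derivative \<gamma>' t) (at t within {a..b})"
  shows "(\<gamma>' has_integral \<gamma> b - \<gamma> a) {a..b}"
proof (rule has_integral_spike[OF S])
  \<comment> \<open>With the value 0 on \<open>S\<close>, a term tagged in \<open>S\<close> leaves
    only the increment of \<open>\<gamma>\<close>, which absolute continuity controls.\<close>
  define g where "g t = (if t \<in> S then 0 else \<gamma>' t)" for t
  show "\<gamma>' t = g t" if "t \<in> {a..b} - S" for t using that by (simp add: g_def)
  show "(g has_integral \<gamma> b - \<gamma> a) {a..b}"
    unfolding has_integral_real
  proof (intro allI impI)
    fix e :: real assume "e > 0"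
    define e1 where "e1 = e / (2 * (b - a + 1))"
    have e1: "e1 > 0" "e1 * (b - a) < e / 2"
      using \<open>e > 0\<close> \<open>a \<le> b\<close> by (auto simp: e1_def field_simps)
    have "e / 2 > 0" using \<open>e > 0\<close> by simp
    obtain \<delta> where \<delta>: "\<delta> > 0" "\<And>\<D>. \<D> division_of \<Union>\<D> \<Longrightarrow> \<Union>\<D> \<subseteq> {a..b} \<Longrightarrow>
      (\<Sum>K\<in>\<D>. Sup K - Inf K) < \<delta> \<Longrightarrow> (\<Sum>K\<in>\<D>. norm (\<gamma> (Sup K) - \<gamma> (Inf K))) < e / 2"
      by (rule abs_continuous_curve_onD[OF ac \<open>e / 2 > 0\<close>]) blast
    obtain U where U: "open U" "S \<subseteq> U" "U \<in> lmeasurable" "measure lebesgue U < \<delta>"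
      using open_cover_of_negligible[OF S \<delta>(1)] .
    have "\<exists>r>0. \<forall>y\<in>{a..b}. \<bar>y - t\<bar> < r \<longrightarrow> norm (\<gamma> y - \<gamma> t - (y - t) *\<^sub>R g t) \<le> e1 * \<bar>y - t\<bar>"
      if "t \<in> {a..b} - S" for t
      using der[OF that] e1(1) that
      unfolding has_vector_derivative_def has_derivative_within_alt by (auto simp: g_def)
    then obtain r where r: "\<And>t. t \<in> {a..b} - S \<Longrightarrow> r t > 0"
      "\<And>t y. t \<in> {a..b} - S \<Longrightarrow> y \<in> {a..b} \<Longrightarrow> \<bar>y - t\<bar> < r t \<Longrightarrow>
         norm (\<gamma> y - \<gamma> t - (y - t) *\<^sub>R g t) \<le> e1 * \<bar>y - t\<bar>"
      by metis
    define G where "G t = (if t \<in> S then U else if t \<in> {a..b} then ball t (r t) else UNIV)" for t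
    show "\<exists>G. gauge G \<and> (\<forall>\<D>. \<D> tagged_division_of {a..b} \<and> G fine \<D> \<longrightarrow>
        norm ((\<Sum>(x, K)\<in>\<D>. measure lborel K *\<^sub>R g x) - (\<gamma> b - \<gamma> a)) < e)"
    proof (intro exI conjI allI impI)
      show "gauge G" using U r(1) by (auto simp: gauge_def G_def)
      fix \<D> assume \<D>: "\<D> tagged_division_of {a..b} \<and> G fine \<D>"
      then have tag: "\<D> tagged_division_of {a..b}" and fine: "\<And>x K. (x, K) \<in> \<D> \<Longrightarrow> K \<subseteq> G x"
        by (auto simp: fine_def)
      note fin = tagged_division_of_finite[OF tag]
      have K: "x \<in> K" "Inf K \<le> x" "x \<le> Sup K" "K \<subseteq> {a..b}" "x \<in> {a..b}"
        "Inf K \<in> K" "Sup K \<in> K" "measure lborel K = Sup K - Inf K"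
        if "(x, K) \<in> \<D>" for x K
      proof -
        obtain u v where "K = cbox u v" using tag \<open>(x, K) \<in> \<D>\<close> by blast
        moreover have "x \<in> K" "K \<subseteq> {a..b}" using tag that by blast+
        ultimately show "x \<in> K" "Inf K \<le> x" "x \<le> Sup K" "K \<subseteq> {a..b}" "x \<in> {a..b}"
          "Inf K \<in> K" "Sup K \<in> K" "measure lborel K = Sup K - Inf K" by auto
      qed
      define \<D>S where "\<D>S = {(x, K) \<in> \<D>. x \<in> S}"
      have sub: "\<D>S \<subseteq> \<D>" by (auto simp: \<D>S_def)
      define E where "E = (\<lambda>(x, K). measure lborel K *\<^sub>R g x - (\<gamma> (Sup K) - \<gamma> (Inf K)))"
      have "(\<Sum>(x, K)\<in>\<D>. \<gamma> (Sup K) - \<gamma> (Inf K)) = \<gamma> b - \<gamma> a"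
        using additive_tagged_division_1[OF \<open>a \<le> b\<close> tag] .
      then have "(\<Sum>(x, K)\<in>\<D>. measure lborel K *\<^sub>R g x) - (\<gamma> b - \<gamma> a) = sum E \<D>"
        by (simp add: E_def sum_subtractf case_prod_beta)
      also have "\<dots> = sum E (\<D> - \<D>S) + sum E \<D>S"
        using fin sub by (simp add: sum.subset_diff)
      also have "norm \<dots> \<le> norm (sum E (\<D> - \<D>S)) + norm (sum E \<D>S)" by (rule norm_triangle_ineq)
      also have "norm (sum E (\<D> - \<D>S)) \<le> (\<Sum>(x, K)\<in>\<D> - \<D>S. e1 * measure lborel K)"
      proof (rule sum_norm_le)
        fix xK assume xK: "xK \<in> \<D> - \<D>S"
        obtain x K where [simp]: "xK = (x, K)" by fastforce
        have mem: "(x, K) \<in> \<D>" "x \<notin> S" using xK by (auto simp: \<D>S_def)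
        note K = K[OF mem(1)]
        have x: "x \<in> {a..b} - S" using K mem by simp
        have near: "norm (\<gamma> y - \<gamma> x - (y - x) *\<^sub>R g x) \<le> e1 * \<bar>y - x\<bar>" if "y \<in> K" for y
        proof (rule r(2)[OF x])
          show "y \<in> {a..b}" using that K by blast
          have "y \<in> ball x (r x)" using fine[OF mem(1)] that x by (auto simp: G_def)
          then show "\<bar>y - x\<bar> < r x" by (simp add: dist_real_def abs_minus_commute)
        qed
        have "E xK = (\<gamma> (Inf K) - \<gamma> x - (Inf K - x) *\<^sub>R g x) - (\<gamma> (Sup K) - \<gamma> x - (Sup K - x) *\<^sub>R g x)"
          by (simp add: E_def K(8) scaleR_diff_left)
        also have "norm \<dots> \<le> e1 * \<bar>Inf K - x\<bar> + e1 * \<bar>Sup K - x\<bar>"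
          using near[OF K(6)] near[OF K(7)] norm_triangle_ineq4 add_mono order_trans by blast
        also have "\<dots> = e1 * measure lborel K" unfolding K(8) using K(2,3) by (simp add: algebra_simps)
        finally show "norm (E xK) \<le> (case xK of (x, K) \<Rightarrow> e1 * measure lborel K)" by simp
      qed
      also have "\<dots> \<le> (\<Sum>(x, K)\<in>\<D>. e1 * measure lborel K)"
        using fin e1(1) by (intro sum_mono2) (auto intro!: mult_nonneg_nonneg)
      also have "\<dots> = e1 * (b - a)"
        using additive_content_tagged_division[of \<D> a b] tag \<open>a \<le> b\<close>
        by (simp add: case_prod_beta flip: sum_distrib_left)
      also have "norm (sum E \<D>S) < e / 2"
      proof -
        have "\<D>S tagged_partial_division_of {a..b}"
          using tagged_partial_division_subset[OF _ sub] tag by (auto simp: tagged_division_of_def)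
        then have tagS: "\<D>S tagged_division_of \<Union> (snd ` \<D>S)"
          by (rule tagged_partial_division_of_Union_self)
        note divS = division_of_tagged_division[OF tagS]
        \<comment> \<open>Passing from tagged intervals to intervals requires the value 0 on
          degenerate ones, including the empty set, where \<open>Sup\<close> and \<open>Inf\<close>
          carry no information.\<close>
        define \<nu> where "\<nu> K = (if K = {} then 0 else norm (\<gamma> (Sup K) - \<gamma> (Inf K)))" for K
        have \<nu>: "\<nu> K = norm (\<gamma> (Sup K) - \<gamma> (Inf K))" if "(x, K) \<in> \<D>S" for x K
          using K(1)[of x K] that sub by (auto simp: \<nu>_def)
        have "norm (sum E \<D>S) \<le> (\<Sum>(x, K)\<in>\<D>S. \<nu> K)"
          using \<nu> by (intro sum_norm_le) (auto simp: \<D>S_def E_def g_def norm_minus_commute)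
        also have "\<dots> = (\<Sum>K\<in>snd ` \<D>S. \<nu> K)"
          by (rule sum.over_tagged_division_lemma[OF tagS]) (auto simp: \<nu>_def)
        also have "\<dots> = (\<Sum>K\<in>snd ` \<D>S. norm (\<gamma> (Sup K) - \<gamma> (Inf K)))"
          using \<nu> by (intro sum.cong) auto
        also have "\<dots> < e / 2"
        proof (rule \<delta>(2)[OF divS])
          show "\<Union> (snd ` \<D>S) \<subseteq> {a..b}" using K(4) sub by fastforce
          have "(\<Sum>K\<in>snd ` \<D>S. Sup K - Inf K) = (\<Sum>K\<in>snd ` \<D>S. measure lebesgue K)"
            using division_of_real_member(6)[OF divS] by (intro sum.cong) simp_all
          also have "\<dots> = measure lebesgue (\<Union> (snd ` \<D>S))" by (rule content_division[OF divS])
          also have "\<dots> \<le> measure lebesgue U"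
          proof (rule measure_mono_fmeasurable)
            show "\<Union> (snd ` \<D>S) \<subseteq> U" using fine by (fastforce simp: \<D>S_def G_def)
            show "\<Union> (snd ` \<D>S) \<in> sets lebesgue"
              using lmeasurable_division[OF divS] by (rule fmeasurableD)
          qed (rule U)
          finally show "(\<Sum>K\<in>snd ` \<D>S. Sup K - Inf K) < \<delta>" using U(4) by linarith
        qed
        finally show ?thesis .
      qed
      finally show "norm ((\<Sum>(x, K)\<in>\<D>. measure lborel K *\<^sub>R g x) - (\<gamma> b - \<gamma> a)) < e"
        using e1(2) by linarith
    qed
  qed
qed

text \<open>On an interval shorter than \<open>\<delta>\<close> every division has variation below
  1, and the integral over a piece is the increment of \<open>\<gamma>\<close>; so the indefinite
  integral has bounded variation there. Bisection combines such intervals.\<close>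

lemma abs_continuous_derivative_absolutely_integrable:
  fixes \<gamma> :: "real \<Rightarrow> 'a::euclidean_space"
  assumes ac: "abs_continuous_curve_on a b \<gamma>" and "a \<le> b"
    and int: "\<And>s t. a \<le> s \<Longrightarrow> s \<le> t \<Longrightarrow> t \<le> b \<Longrightarrow> (\<gamma>' has_integral \<gamma> t - \<gamma> s) {s..t}"
  shows "\<gamma>' absolutely_integrable_on {a..b}"
proof -
  obtain \<delta> where \<delta>: "\<delta> > 0" "\<And>\<D>. \<D> division_of \<Union>\<D> \<Longrightarrow> \<Union>\<D> \<subseteq> {a..b} \<Longrightarrow>
    (\<Sum>K\<in>\<D>. Sup K - Inf K) < \<delta> \<Longrightarrow> (\<Sum>K\<in>\<D>. norm (\<gamma> (Sup K) - \<gamma> (Inf K))) < 1"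
    by (rule abs_continuous_curve_onD[OF ac, of 1]) auto
  have short: "\<gamma>' absolutely_integrable_on {s..t}" if st: "a \<le> s" "s \<le> t" "t \<le> b" "t - s < \<delta>" for s t
    unfolding box_real(2)[symmetric]
  proof (rule bounded_variation_absolutely_integrable_interval)
    show "\<gamma>' integrable_on cbox s t" using int st by auto
    fix \<D> assume \<D>: "\<D> division_of cbox s t"
    then have un: "\<Union>\<D> = {s..t}" by auto
    note mem = division_of_real_member[OF \<D>]
    have eq: "integral K \<gamma>' = \<gamma> (Sup K) - \<gamma> (Inf K)" if "K \<in> \<D>" for K
    proof -
      have "K \<subseteq> {s..t}" using that un by blast
      then have "Inf K \<in> {s..t}" "Sup K \<in> {s..t}" using mem(3,4)[OF that] by blast+
      then have "(\<gamma>' has_integral \<gamma> (Sup K) - \<gamma> (Inf K)) {Inf K..Sup K}"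
        using st mem(1)[OF that] by (intro int) auto
      then show ?thesis unfolding mem(2)[OF that, symmetric] by (rule integral_unique)
    qed
    have "(\<Sum>K\<in>\<D>. Sup K - Inf K) = (\<Sum>K\<in>\<D>. measure lborel K)"
      by (intro sum.cong) (simp_all add: mem(5))
    also have "\<dots> = t - s" using additive_content_division[OF \<D>] st by simp
    finally have "(\<Sum>K\<in>\<D>. norm (\<gamma> (Sup K) - \<gamma> (Inf K))) < 1"
      using \<D> un st by (intro \<delta>(2)) auto
    then show "(\<Sum>K\<in>\<D>. norm (integral K \<gamma>')) \<le> 1" by (simp add: eq)
  qed
  have "a \<le> s \<longrightarrow> t \<le> b \<longrightarrow> \<gamma>' absolutely_integrable_on {s..t}" if "s \<le> t" for s t
    using that
  proof (induction rule: Bolzano)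
    case (trans u v w)
    show ?case
    proof (intro impI)
      assume "a \<le> u" "w \<le> b"
      with trans have "\<gamma>' absolutely_integrable_on {u..v}" "\<gamma>' absolutely_integrable_on {v..w}"
        by simp_all
      then show "\<gamma>' absolutely_integrable_on {u..w}"
        using \<open>u \<le> v\<close> \<open>v \<le> w\<close> by (rule absolutely_integrable_on_combine)
    qed
  next
    case (local x)
    show ?case
    proof (intro exI[of _ \<delta>] conjI allI impI \<delta>(1))
      fix u v assume "u \<le> x \<and> x \<le> v \<and> v - u < \<delta>" "a \<le> u" "v \<le> b"
      then show "\<gamma>' absolutely_integrable_on {u..v}" by (intro short) simp_all
    qed
  qed
  from this[of a b] \<open>a \<le> b\<close> show ?thesis by simp
qed

subsection \<open>Horizontal curves and the Carnot-Caratheodory metric\<close>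

lemma symp_simps:
  "symp (u + v) w = symp u w + symp v w" "symp u (v + w) = symp u v + symp u w"
  "symp (c *\<^sub>R u) v = c * symp u v" "symp u (c *\<^sub>R v) = c * symp u v"
  "symp (- u) v = - symp u v" "symp u (- v) = - symp u v"
  "symp u u = 0" "symp 0 u = 0" "symp u 0 = 0"
  by (simp_all add: symp_def inner_add_left inner_add_right inner_commute algebra_simps)

lemma symp_commute: "symp u v = - symp v u"
  by (simp add: symp_def inner_commute)

lemma abs_symp_le:
  fixes u v :: "'n::finite horiz"
  shows "\<bar>symp u v\<bar> \<le> 2 * (norm u * norm v)"
proof -
  have le: "norm (fst x) \<le> norm x" "norm (snd x) \<le> norm x" for x :: "'n horiz"
    using norm_fst_le[of "fst x" "snd x"] norm_snd_le[of "snd x" "fst x"] by simp_all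
  have "\<bar>fst u \<bullet> snd v\<bar> \<le> norm (fst u) * norm (snd v)" "\<bar>snd u \<bullet> fst v\<bar> \<le> norm (snd u) * norm (fst v)"
    by (rule Cauchy_Schwarz_ineq2)+
  moreover have "norm (fst u) * norm (snd v) \<le> norm u * norm v"
    by (intro mult_mono le) simp_all
  moreover have "norm (snd u) * norm (fst v) \<le> norm u * norm v"
    by (intro mult_mono le) simp_all
  ultimately show ?thesis unfolding symp_def by linarith
qed

lemma negligible_affine_preimage:
  fixes S :: "real set"
  assumes "negligible S" "m \<noteq> 0"
  shows "negligible {t. m * t + c \<in> S}"
proof -
  have "{t. m * t + c \<in> S} = (\<lambda>x. (x - c) / m) ` S"
  proof (intro equalityI subsetI)
    fix t assume "t \<in> {t. m * t + c \<in> S}"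
    then show "t \<in> (\<lambda>x. (x - c) / m) ` S"
      using \<open>m \<noteq> 0\<close> by (intro image_eqI[of _ _ "m * t + c"]) simp_all
  next
    fix t assume "t \<in> (\<lambda>x. (x - c) / m) ` S"
    then obtain x where "x \<in> S" "t = (x - c) / m" by blast
    then show "t \<in> {t. m * t + c \<in> S}" using \<open>m \<noteq> 0\<close> by simp
  qed
  moreover have "(\<lambda>x. (x - c) / m) differentiable_on S"
    unfolding differentiable_on_def real_differentiable_def using \<open>m \<noteq> 0\<close>
    by (intro ballI exI) (auto intro!: derivative_eq_intros)
  ultimately show ?thesis
    using negligible_differentiable_image_negligible[of S "\<lambda>x. (x - c) / m"] assms(1) by simp
qed

section \<open>Horizontal curves on an interval\<close>

definition horizontal_on :: "real \<Rightarrow> real \<Rightarrow> (real \<Rightarrow> 'n::finite heis) \<Rightarrow> bool" where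
  "horizontal_on a b \<gamma> \<longleftrightarrow> abs_continuous_curve_on a b \<gamma> \<and>
     (AE t in lebesgue. t \<in> {a<..<b} \<longrightarrow> (\<exists>v. (\<gamma> has_vector_derivative left_field (\<gamma> t) v) (at t)))"

definition velocity :: "(real \<Rightarrow> 'n::finite heis) \<Rightarrow> real \<Rightarrow> 'n horiz" where
  "velocity \<gamma> t = fst (vector_derivative \<gamma> (at t))"

lemma velocity_eq:
  assumes "(\<gamma> has_vector_derivative left_field p v) (at t)"
  shows "velocity \<gamma> t = v"
  using vector_derivative_at[OF assms] by (simp add: velocity_def left_field_def)

lemma horizontal_curve_iff_horizontal_on: "horizontal_curve \<gamma> \<longleftrightarrow> horizontal_on 0 1 \<gamma>"
  by (simp add: horizontal_curve_def horizontal_on_def)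

lemma horizontal_onI:
  assumes "abs_continuous_curve_on a b \<gamma>" "negligible S"
    and "\<And>t. t \<in> {a<..<b} \<Longrightarrow> t \<notin> S \<Longrightarrow> \<exists>v. (\<gamma> has_vector_derivative left_field (\<gamma> t) v) (at t)"
  shows "horizontal_on a b \<gamma>"
  unfolding horizontal_on_def eventually_ae_filter_negligible
  using assms by (intro conjI exI[of _ S]) auto

text \<open>\<open>horizontal_on\<close> provides two-sided derivatives in the open interval only,
  so the endpoints join the exceptional set.\<close>

lemma horizontal_onE:
  assumes "horizontal_on a b \<gamma>"
  obtains S where "abs_continuous_curve_on a b \<gamma>" "negligible S" "a \<in> S" "b \<in> S"
    "\<And>t. t \<in> {a..b} - S \<Longrightarrow> (\<gamma> has_vector_derivative left_field (\<gamma> t) (velocity \<gamma> t)) (at t)"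
proof -
  from assms obtain S where S: "abs_continuous_curve_on a b \<gamma>" "negligible S"
    "{t. \<not> (t \<in> {a<..<b} \<longrightarrow> (\<exists>v. (\<gamma> has_vector_derivative left_field (\<gamma> t) v) (at t)))} \<subseteq> S"
    unfolding horizontal_on_def eventually_ae_filter_negligible by blast
  show thesis
  proof (rule that[of "insert a (insert b S)"])
    show "negligible (insert a (insert b S))" using S(2) by simp
    fix t assume t: "t \<in> {a..b} - insert a (insert b S)"
    then have "t \<in> {a<..<b}" by auto
    then obtain v where v: "(\<gamma> has_vector_derivative left_field (\<gamma> t) v) (at t)" using S(3) t by blast
    then show "(\<gamma> has_vector_derivative left_field (\<gamma> t) (velocity \<gamma> t)) (at t)"
      using velocity_eq[OF v] by simp
  qed (use S(1) in auto)
qed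

text \<open>The fundamental theorem, split into components. The horizontal one bounds projections by
  lengths; the vertical one is the symplectic area formula, which bounds heights by squares of
  lengths.\<close>

lemma horizontal_on_integrals:
  fixes \<gamma> :: "real \<Rightarrow> 'n::finite heis"
  assumes "horizontal_on a b \<gamma>" "a \<le> b"
  shows "velocity \<gamma> absolutely_integrable_on {a..b}"
    and "\<And>s t. a \<le> s \<Longrightarrow> s \<le> t \<Longrightarrow> t \<le> b \<Longrightarrow> (velocity \<gamma> has_integral fst (\<gamma> t) - fst (\<gamma> s)) {s..t}"
    and "((\<lambda>t. symp (fst (\<gamma> t)) (velocity \<gamma> t) / 2) has_integral snd (\<gamma> b) - snd (\<gamma> a)) {a..b}"
proof -
  obtain S where S: "abs_continuous_curve_on a b \<gamma>" "negligible S" "a \<in> S" "b \<in> S"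
    "\<And>t. t \<in> {a..b} - S \<Longrightarrow> (\<gamma> has_vector_derivative left_field (\<gamma> t) (velocity \<gamma> t)) (at t)"
    by (rule horizontal_onE[OF assms(1)]) blast
  define W where "W t = left_field (\<gamma> t) (velocity \<gamma> t)" for t
  have W: "(W has_integral \<gamma> t - \<gamma> s) {s..t}" if "a \<le> s" "s \<le> t" "t \<le> b" for s t
  proof (rule abs_continuous_has_integral[OF _ that(2) S(2)])
    show "abs_continuous_curve_on s t \<gamma>"
      by (rule abs_continuous_curve_on_subset[OF S(1)]) (use that in auto)
    show "(\<gamma> has_vector_derivative W u) (at u within {s..t})" if "u \<in> {s..t} - S" for u
      unfolding W_def
      by (rule has_vector_derivative_at_within, rule S(5)) (use that \<open>a \<le> s\<close> \<open>t \<le> b\<close> in auto)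
  qed
  have WI: "W absolutely_integrable_on {a..b}"
    by (rule abs_continuous_derivative_absolutely_integrable[OF S(1) assms(2) W])
  have fst: "fst \<circ> W = velocity \<gamma>" by (auto simp: W_def left_field_def)
  have snd: "snd \<circ> W = (\<lambda>t. symp (fst (\<gamma> t)) (velocity \<gamma> t) / 2)" by (auto simp: W_def left_field_def)
  show "velocity \<gamma> absolutely_integrable_on {a..b}"
    using absolutely_integrable_linear[OF WI bounded_linear_fst] by (simp only: fst)
  show "(velocity \<gamma> has_integral fst (\<gamma> t) - fst (\<gamma> s)) {s..t}" if "a \<le> s" "s \<le> t" "t \<le> b" for s t
    using has_integral_linear[OF W[OF that] bounded_linear_fst] by (simp only: fst fst_diff)
  show "((\<lambda>t. symp (fst (\<gamma> t)) (velocity \<gamma> t) / 2) has_integral snd (\<gamma> b) - snd (\<gamma> a)) {a..b}"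
    using has_integral_linear[OF W[OF order_refl assms(2) order_refl] bounded_linear_snd]
    by (simp only: snd snd_diff)
qed

locale heis_metric =
  fixes g :: "'n::finite horiz \<Rightarrow> 'n horiz \<Rightarrow> real"
  assumes ip: "inner_product g"
begin

definition N :: "'n horiz \<Rightarrow> real" where "N v = sqrt (g v v)"

lemma bounded_bilinear_g: "bounded_bilinear g"
  using ip unfolding inner_product_def bilinear_conv_bounded_bilinear by blast

interpretation g: bounded_bilinear g by (rule bounded_bilinear_g)

lemma g_commute: "g u v = g v u" and g_pos: "v \<noteq> 0 \<Longrightarrow> g v v > 0"
  using ip unfolding inner_product_def by blast+

lemma g_nonneg: "g v v \<ge> 0"
  using g_pos[of v] by (cases "v = 0") (auto simp: g.zero_left)

lemma N_nonneg: "N v \<ge> 0" and N_squared: "(N v)\<^sup>2 = g v v" and N_pos: "v \<noteq> 0 \<Longrightarrow> N v > 0"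
  using g_nonneg g_pos by (simp_all add: N_def)

lemma N_scaleR: "N (c *\<^sub>R v) = \<bar>c\<bar> * N v"
  by (simp add: N_def g.scaleR_left g.scaleR_right real_sqrt_mult flip: mult.assoc)

lemma N_zero: "N 0 = 0" by (simp add: N_def g.zero_left)

lemma N_Cauchy_Schwarz: "g u v \<le> N u * N v"
proof (cases "v = 0")
  case False
  define c where "c = g u v / g v v"
  have "0 \<le> g (u - c *\<^sub>R v) (u - c *\<^sub>R v)" by (rule g_nonneg)
  also have "\<dots> = g u u - 2 * c * g u v + c\<^sup>2 * g v v"
    by (simp add: g.diff_left g.diff_right g.scaleR_left g.scaleR_right g_commute[of v u] power2_eq_square algebra_simps)
  also have "\<dots> = g u u - (g u v)\<^sup>2 / g v v"
    using g_pos[OF False] by (simp add: c_def power2_eq_square field_simps)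
  finally have "(g u v)\<^sup>2 \<le> g u u * g v v" using g_pos[OF False] by (simp add: field_simps)
  also have "\<dots> = (N u * N v)\<^sup>2" by (simp add: power_mult_distrib N_squared)
  finally show ?thesis using N_nonneg by (meson mult_nonneg_nonneg power2_le_imp_le)
qed (simp add: g.zero_right N_zero)

lemma continuous_N: "continuous_on S N"
  unfolding N_def by (intro continuous_intros g.continuous_on)

lemma norm_le_N: obtains c where "c > 0" "\<And>v. norm v \<le> c * N v"
proof -
  have sphere: "compact (sphere (0 :: 'n horiz) 1)" "sphere (0 :: 'n horiz) 1 \<noteq> {}" by simp_all
  from continuous_attains_inf[OF sphere continuous_N]
  obtain e where e: "e \<in> sphere 0 1" "\<forall>v\<in>sphere 0 1. N e \<le> N v" by blast
  have "N e > 0" using e(1) by (intro N_pos) auto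
  have le: "norm v \<le> (1 / N e) * N v" for v
  proof (cases "v = 0")
    case False
    then have "(1 / norm v) *\<^sub>R v \<in> sphere 0 1" by simp
    with e(2) have "N e \<le> N ((1 / norm v) *\<^sub>R v)" by blast
    also have "\<dots> = N v / norm v" by (simp add: N_scaleR)
    finally show ?thesis using False \<open>N e > 0\<close> by (simp add: field_simps)
  qed (simp add: N_zero)
  show thesis by (rule that[OF _ le]) (use \<open>N e > 0\<close> in simp)
qed

lemma N_le_norm: obtains c where "\<And>v. N v \<le> c * norm v"
proof -
  obtain K where K: "K \<ge> 0" "\<And>u v. norm (g u v) \<le> norm u * norm v * K"
    using g.nonneg_bounded by blast
  have "N v \<le> sqrt K * norm v" for v
  proof -
    have "N v \<le> sqrt ((norm v)\<^sup>2 * K)"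
      unfolding N_def using K(2)[of v v] by (simp add: power2_eq_square)
    then show ?thesis by (simp add: real_sqrt_mult mult_ac)
  qed
  then show thesis by (rule that)
qed

lemma horizontal_on_speed_integrable:
  assumes "horizontal_on a b \<gamma>" "a \<le> b"
  shows "(\<lambda>t. N (velocity \<gamma> t)) integrable_on {a..b}"
proof -
  obtain c where c: "\<And>v. N v \<le> c * norm v" by (rule N_le_norm) blast
  have vel: "velocity \<gamma> absolutely_integrable_on {a..b}" by (rule horizontal_on_integrals[OF assms])
  have "velocity \<gamma> \<in> borel_measurable (lebesgue_on {a..b})"
    by (rule absolutely_integrable_imp_borel_measurable[OF vel]) simp
  then have "(\<lambda>t. N (velocity \<gamma> t)) \<in> borel_measurable (lebesgue_on {a..b})"
    by (rule measurable_compose) (intro borel_measurable_continuous_onI continuous_N)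
  moreover have "(\<lambda>t. c * norm (velocity \<gamma> t)) integrable_on {a..b}"
    using vel by (intro integrable_on_mult_right) (simp add: absolutely_integrable_on_def)
  ultimately show ?thesis
    by (rule measurable_bounded_by_integrable_imp_integrable_real) (use c N_nonneg in auto)
qed

text \<open>Pairing the integral with \<open>x\<close> itself and applying Cauchy-Schwarz under the
  integral gives \<open>g x x \<le> N x * l\<close>; it remains to divide by
  \<open>N x\<close>.\<close>

lemma N_integral_le:
  assumes "(v has_integral x) T" "((\<lambda>t. N (v t)) has_integral l) T"
  shows "N x \<le> l"
proof (cases "N x = 0")
  case True
  then show ?thesis using has_integral_nonneg[OF assms(2)] N_nonneg by simp
next
  case False
  have "((\<lambda>t. g x (v t)) has_integral g x x) T"
    using has_integral_linear[OF assms(1) g.bounded_linear_right] by (simp add: o_def)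
  moreover have "((\<lambda>t. N x * N (v t)) has_integral N x * l) T"
    by (rule has_integral_mult_right[OF assms(2)])
  ultimately have "g x x \<le> N x * l" by (rule has_integral_le) (rule N_Cauchy_Schwarz)
  then have "N x * N x \<le> N x * l" by (simp add: N_squared[symmetric] power2_eq_square)
  then show ?thesis using False N_nonneg[of x] by simp
qed

section \<open>Points joined by a horizontal curve of given length\<close>

text \<open>Length as a relation keeps the integrability of the speed together with its integral, so
  that curves can be transformed and concatenated by the rules for \<open>has_integral\<close>
  before any infimum is taken.\<close>

definition joined :: "'n heis \<Rightarrow> 'n heis \<Rightarrow> real \<Rightarrow> bool" where
  "joined p q l \<longleftrightarrow> (\<exists>\<gamma>. horizontal_on 0 1 \<gamma> \<and> \<gamma> 0 = p \<and> \<gamma> 1 = q \<and> ((\<lambda>t. N (velocity \<gamma> t)) has_integral l) {0..1})"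

lemma cc_dist_eq: "cc_dist g p q = Inf {l. joined p q l}"
proof -
  have "cc_length g \<gamma> = integral {0..1} (\<lambda>t. N (velocity \<gamma> t))" for \<gamma>
    by (simp add: cc_length_def N_def velocity_def Let_def)
  moreover have "((\<lambda>t. N (velocity \<gamma> t)) has_integral l) {0..1} \<longleftrightarrow> l = integral {0..1} (\<lambda>t. N (velocity \<gamma> t))"
    if "horizontal_on 0 1 \<gamma>" for \<gamma> :: "real \<Rightarrow> 'n heis" and l
    using horizontal_on_speed_integrable[OF that] by (auto simp: has_integral_iff)
  ultimately have "{cc_length g \<gamma> |\<gamma>. horizontal_curve \<gamma> \<and> \<gamma> 0 = p \<and> \<gamma> 1 = q} = {l. joined p q l}"
    unfolding joined_def horizontal_curve_iff_horizontal_on by auto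
  then show ?thesis by (simp add: cc_dist_def)
qed

lemma joined_nonneg: "joined p q l \<Longrightarrow> l \<ge> 0"
  unfolding joined_def using has_integral_nonneg N_nonneg by blast

lemma N_le_joined: assumes "joined p q l" shows "N (fst q - fst p) \<le> l"
proof -
  obtain \<gamma> where \<gamma>: "horizontal_on 0 1 \<gamma>" "\<gamma> 0 = p" "\<gamma> 1 = q" "((\<lambda>t. N (velocity \<gamma> t)) has_integral l) {0..1}"
    using assms unfolding joined_def by blast
  have "(velocity \<gamma> has_integral fst (\<gamma> 1) - fst (\<gamma> 0)) {0..1}" by (rule horizontal_on_integrals[OF \<gamma>(1)]) simp_all
  from N_integral_le[OF this \<gamma>(4)] show ?thesis by (simp add: \<gamma>)
qed

text \<open>The height is half the integral of \<open>symp\<close> of position and velocity. The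
  curve starts at the origin, so the position is bounded by a multiple of \<open>l\<close>
  throughout, and the speed integrates to another \<open>l\<close>. This makes
  \<open>\<kappa>\<close> positive.\<close>

lemma vertical_le_joined:
  obtains c where "c > 0" "\<And>t l. joined (0, 0) (0, t) l \<Longrightarrow> \<bar>t\<bar> \<le> c * l\<^sup>2"
proof -
  obtain c where c: "c > 0" "\<And>v. norm v \<le> c * N v" by (rule norm_le_N) blast
  have "\<bar>t\<bar> \<le> c\<^sup>2 * l\<^sup>2" if joined: "joined (0, 0) (0, t) l" for t l
  proof -
    obtain \<gamma> where \<gamma>: "horizontal_on 0 1 \<gamma>" "\<gamma> 0 = (0, 0)" "\<gamma> 1 = (0, t)"
      "((\<lambda>t. N (velocity \<gamma> t)) has_integral l) {0..1}"
      using joined unfolding joined_def by blast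
    have x: "N (fst (\<gamma> s)) \<le> l" if "s \<in> {0..1}" for s
    proof -
      have "(velocity \<gamma> has_integral fst (\<gamma> s) - fst (\<gamma> 0)) {0..s}"
        by (rule horizontal_on_integrals[OF \<gamma>(1)]) (use that in auto)
      moreover have int: "(\<lambda>t. N (velocity \<gamma> t)) integrable_on {0..s}"
        by (rule integrable_subinterval_real[OF has_integral_integrable[OF \<gamma>(4)]]) (use that in auto)
      then have "((\<lambda>t. N (velocity \<gamma> t)) has_integral integral {0..s} (\<lambda>t. N (velocity \<gamma> t))) {0..s}"
        by (rule integrable_integral)
      ultimately have "N (fst (\<gamma> s) - fst (\<gamma> 0)) \<le> integral {0..s} (\<lambda>t. N (velocity \<gamma> t))"
        by (rule N_integral_le)
      also have "\<dots> \<le> integral {0..1} (\<lambda>t. N (velocity \<gamma> t))"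
        using that N_nonneg by (intro integral_subset_le int has_integral_integrable[OF \<gamma>(4)]) auto
      also have "\<dots> = l" using \<gamma>(4) by (rule integral_unique)
      finally show ?thesis by (simp add: \<gamma>)
    qed
    have bound: "\<bar>symp (fst (\<gamma> s)) (velocity \<gamma> s) / 2\<bar> \<le> c\<^sup>2 * l * N (velocity \<gamma> s)" if "s \<in> {0..1}" for s
    proof -
      have "\<bar>symp (fst (\<gamma> s)) (velocity \<gamma> s) / 2\<bar> \<le> norm (fst (\<gamma> s)) * norm (velocity \<gamma> s)"
        using abs_symp_le[of "fst (\<gamma> s)" "velocity \<gamma> s"] by simp
      also have "\<dots> \<le> (c * N (fst (\<gamma> s))) * (c * N (velocity \<gamma> s))"
        using c N_nonneg by (intro mult_mono) auto
      also have "\<dots> \<le> (c * l) * (c * N (velocity \<gamma> s))"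
        using c N_nonneg x[OF that] by (intro mult_right_mono mult_left_mono) auto
      finally show ?thesis by (simp add: power2_eq_square mult_ac)
    qed
    have "(\<lambda>s. symp (fst (\<gamma> s)) (velocity \<gamma> s) / 2) integrable_on {0..1}"
      "integral {0..1} (\<lambda>s. symp (fst (\<gamma> s)) (velocity \<gamma> s) / 2) = t"
      using horizontal_on_integrals(3)[OF \<gamma>(1)] by (auto simp: \<gamma> has_integral_iff)
    moreover have "((\<lambda>s. c\<^sup>2 * l * N (velocity \<gamma> s)) has_integral c\<^sup>2 * l * l) {0..1}"
      by (rule has_integral_mult_right[OF \<gamma>(4)])
    ultimately have "norm t \<le> c\<^sup>2 * l * l"
      using integral_norm_bound_integral[of "\<lambda>s. symp (fst (\<gamma> s)) (velocity \<gamma> s) / 2" "{0..1}"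
          "\<lambda>s. c\<^sup>2 * l * N (velocity \<gamma> s)"] bound
      by (auto simp: has_integral_iff)
    then show ?thesis by (simp add: power2_eq_square mult_ac)
  qed
  with c(1) show thesis by (intro that[of "c\<^sup>2"]) auto
qed

text \<open>Left translations (with r = 1) and dilations are affine in these coordinates and send
  left-invariant fields to multiples of such; both are instances.\<close>

lemma joined_linear_image:
  assumes "joined p q l" "bounded_linear A" "\<And>x. \<Phi> x = A x + c"
    and A: "\<And>x v. A (left_field x v) = left_field (\<Phi> x) (r *\<^sub>R v)"
  shows "joined (\<Phi> p) (\<Phi> q) (\<bar>r\<bar> * l)"
proof -
  obtain \<gamma> where \<gamma>: "horizontal_on 0 1 \<gamma>" "\<gamma> 0 = p" "\<gamma> 1 = q" "((\<lambda>t. N (velocity \<gamma> t)) has_integral l) {0..1}"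
    using assms(1) unfolding joined_def by blast
  obtain S where S: "abs_continuous_curve_on 0 1 \<gamma>" "negligible S" "0 \<in> S" "1 \<in> S"
    "\<And>t. t \<in> {0..1} - S \<Longrightarrow> (\<gamma> has_vector_derivative left_field (\<gamma> t) (velocity \<gamma> t)) (at t)"
    by (rule horizontal_onE[OF \<gamma>(1)]) blast
  define \<beta> where "\<beta> t = \<Phi> (\<gamma> t)" for t
  have der: "(\<beta> has_vector_derivative left_field (\<beta> t) (r *\<^sub>R velocity \<gamma> t)) (at t)" if "t \<in> {0..1} - S" for t
  proof -
    have "((\<lambda>t. A (\<gamma> t) + c) has_vector_derivative A (left_field (\<gamma> t) (velocity \<gamma> t))) (at t)"
      using bounded_linear.has_vector_derivative[OF assms(2) S(5)[OF that]]
      by (simp add: has_vector_derivative_add_const)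
    then show ?thesis by (simp add: A) (simp add: \<beta>_def[abs_def] assms(3))
  qed
  have "horizontal_on 0 1 \<beta>"
  proof (rule horizontal_onI[OF _ S(2)])
    obtain K where "\<And>x. norm (A x) \<le> norm x * K" using bounded_linear.bounded[OF assms(2)] by blast
    then have "norm (\<beta> s - \<beta> t) \<le> K * norm (\<gamma> s - \<gamma> t)" for s t
      using bounded_linear.axioms(1)[OF assms(2)]
      by (simp add: \<beta>_def assms(3) mult.commute linear_diff[symmetric])
    then show "abs_continuous_curve_on 0 1 \<beta>"
      by (intro abs_continuous_curve_on_Lipschitz_image[OF S(1)])
    show "\<exists>v. (\<beta> has_vector_derivative left_field (\<beta> t) v) (at t)" if "t \<in> {0<..<1}" "t \<notin> S" for t
      by (intro exI, rule der) (use that in auto)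
  qed
  moreover have "((\<lambda>t. N (velocity \<beta> t)) has_integral \<bar>r\<bar> * l) {0..1}"
    by (rule has_integral_spike[OF S(2) _ has_integral_mult_right[OF \<gamma>(4)]])
      (use velocity_eq[OF der] in \<open>auto simp: N_scaleR\<close>)
  ultimately show ?thesis unfolding joined_def using \<gamma>(2,3) by (auto simp: \<beta>_def intro!: exI[of _ \<beta>])
qed

text \<open>Describing the parameter interval by membership treats negative \<open>m\<close>, the
  reversed curve, on the same footing. The speed gains a factor |m|, which cancels the one from the
  substitution.\<close>

lemma horizontal_on_affine_reparametrize:
  assumes "horizontal_on a b \<gamma>" "((\<lambda>t. N (velocity \<gamma> t)) has_integral l) {a..b}" "m \<noteq> 0"
    and cl: "\<And>t. t \<in> {a'..b'} \<longleftrightarrow> m * t + c \<in> {a..b}"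
  shows "horizontal_on a' b' (\<lambda>t. \<gamma> (m * t + c))"
    and "((\<lambda>t. N (velocity (\<lambda>t. \<gamma> (m * t + c)) t)) has_integral l) {a'..b'}"
proof -
  obtain S where S: "abs_continuous_curve_on a b \<gamma>" "negligible S" "a \<in> S" "b \<in> S"
    "\<And>t. t \<in> {a..b} - S \<Longrightarrow> (\<gamma> has_vector_derivative left_field (\<gamma> t) (velocity \<gamma> t)) (at t)"
    by (rule horizontal_onE[OF assms(1)]) blast
  define S' where "S' = {t. m * t + c \<in> S}"
  have S': "negligible S'" unfolding S'_def by (rule negligible_affine_preimage) fact+
  define \<beta> where "\<beta> t = \<gamma> (m * t + c)" for t
  have der: "(\<beta> has_vector_derivative left_field (\<beta> t) (m *\<^sub>R velocity \<gamma> (m * t + c))) (at t)"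
    if "t \<in> {a'..b'} - S'" for t
  proof -
    have "((\<lambda>t. m * t + c) has_vector_derivative m) (at t)"
      by (auto intro!: derivative_eq_intros)
    moreover have "(\<gamma> has_vector_derivative left_field (\<gamma> (m * t + c)) (velocity \<gamma> (m * t + c))) (at (m * t + c))"
      using that cl by (intro S(5)) (auto simp: S'_def)
    ultimately have "((\<gamma> \<circ> (\<lambda>t. m * t + c)) has_vector_derivative
        m *\<^sub>R left_field (\<gamma> (m * t + c)) (velocity \<gamma> (m * t + c))) (at t)"
      by (rule vector_diff_chain_at)
    then show ?thesis by (simp add: o_def \<beta>_def[abs_def] left_field_def symp_simps)
  qed
  show "horizontal_on a' b' (\<lambda>t. \<gamma> (m * t + c))"
    unfolding \<beta>_def[symmetric]
  proof (rule horizontal_onI[OF _ S'])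
    show "abs_continuous_curve_on a' b' \<beta>"
      unfolding \<beta>_def
    proof (rule abs_continuous_curve_on_reparametrize[OF S(1)])
      show "\<bar>m * s + c - (m * t + c)\<bar> \<le> \<bar>m\<bar> * \<bar>s - t\<bar>" for s t
        by (simp add: abs_mult flip: right_diff_distrib)
      show "mono (\<lambda>t. m * t + c) \<or> antimono (\<lambda>t. m * t + c)"
        by (cases "m \<ge> 0") (auto simp: mono_def antimono_def mult_left_mono mult_left_mono_neg)
    qed (use cl in blast)
    show "\<exists>v. (\<beta> has_vector_derivative left_field (\<beta> t) v) (at t)" if "t \<in> {a'<..<b'}" "t \<notin> S'" for t
      by (intro exI, rule der) (use that in auto)
  qed
  have img: "(\<lambda>x. (1 / m) *\<^sub>R x + - ((1 / m) *\<^sub>R c)) ` cbox a b = {a'..b'}"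
  proof (intro equalityI subsetI)
    fix t assume "t \<in> {a'..b'}"
    then have "m * t + c \<in> cbox a b" using cl by simp
    moreover have "t = (1 / m) *\<^sub>R (m * t + c) + - ((1 / m) *\<^sub>R c)" using \<open>m \<noteq> 0\<close> by (simp add: field_simps)
    ultimately show "t \<in> (\<lambda>x. (1 / m) *\<^sub>R x + - ((1 / m) *\<^sub>R c)) ` cbox a b" by blast
  next
    fix t assume "t \<in> (\<lambda>x. (1 / m) *\<^sub>R x + - ((1 / m) *\<^sub>R c)) ` cbox a b"
    then obtain x where x: "x \<in> {a..b}" "t = (1 / m) *\<^sub>R x + - ((1 / m) *\<^sub>R c)" by auto
    then have "m * t + c = x" using \<open>m \<noteq> 0\<close> by (simp add: field_simps)
    with x(1) show "t \<in> {a'..b'}" using cl by simp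
  qed
  have "((\<lambda>t. N (velocity \<gamma> t)) has_integral l) (cbox a b)" using assms(2) by simp
  from has_integral_affinity[OF this \<open>m \<noteq> 0\<close>, of c]
  have "((\<lambda>t. N (velocity \<gamma> (m *\<^sub>R t + c))) has_integral (1 / \<bar>m\<bar> ^ DIM(real)) *\<^sub>R l) {a'..b'}"
    unfolding img .
  from has_integral_mult_right[OF this, of "\<bar>m\<bar>"]
  have int: "((\<lambda>t. \<bar>m\<bar> * N (velocity \<gamma> (m * t + c))) has_integral l) {a'..b'}" using \<open>m \<noteq> 0\<close> by simp
  show "((\<lambda>t. N (velocity (\<lambda>t. \<gamma> (m * t + c)) t)) has_integral l) {a'..b'}"
    unfolding \<beta>_def[symmetric]
    by (rule has_integral_spike[OF S' _ int]) (use velocity_eq[OF der] in \<open>auto simp: N_scaleR\<close>)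
qed

lemma joined_commute: assumes "joined p q l" shows "joined q p l"
proof -
  obtain \<gamma> where \<gamma>: "horizontal_on 0 1 \<gamma>" "\<gamma> 0 = p" "\<gamma> 1 = q" "((\<lambda>t. N (velocity \<gamma> t)) has_integral l) {0..1}"
    using assms unfolding joined_def by blast
  have "t \<in> {0..1} \<longleftrightarrow> - 1 * t + 1 \<in> {0..1}" for t :: real by auto
  from horizontal_on_affine_reparametrize[OF \<gamma>(1,4) _ this] show ?thesis
    unfolding joined_def using \<gamma>(2,3) by (intro exI[of _ "\<lambda>t. \<gamma> (- 1 * t + 1)"]) simp
qed

lemma joined_trans: assumes "joined p q l" "joined q r k" shows "joined p r (l + k)"
proof -
  obtain \<gamma>1 where \<gamma>1: "horizontal_on 0 1 \<gamma>1" "\<gamma>1 0 = p" "\<gamma>1 1 = q" "((\<lambda>t. N (velocity \<gamma>1 t)) has_integral l) {0..1}"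
    using assms(1) unfolding joined_def by blast
  obtain \<gamma>2 where \<gamma>2: "horizontal_on 0 1 \<gamma>2" "\<gamma>2 0 = q" "\<gamma>2 1 = r" "((\<lambda>t. N (velocity \<gamma>2 t)) has_integral k) {0..1}"
    using assms(2) unfolding joined_def by blast
  define \<beta>1 where "\<beta>1 t = \<gamma>1 (2 * t + 0)" for t
  define \<beta>2 where "\<beta>2 t = \<gamma>2 (2 * t + - 1)" for t
  have 1: "t \<in> {0..1/2} \<longleftrightarrow> 2 * t + 0 \<in> {0..1}" for t :: real by auto
  have 2: "t \<in> {1/2..1} \<longleftrightarrow> 2 * t + - 1 \<in> {0..1}" for t :: real by auto
  have \<beta>1: "horizontal_on 0 (1/2) \<beta>1" "((\<lambda>t. N (velocity \<beta>1 t)) has_integral l) {0..1/2}"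
    using horizontal_on_affine_reparametrize[OF \<gamma>1(1,4) _ 1] by (simp_all add: \<beta>1_def[abs_def])
  have \<beta>2: "horizontal_on (1/2) 1 \<beta>2" "((\<lambda>t. N (velocity \<beta>2 t)) has_integral k) {1/2..1}"
    using horizontal_on_affine_reparametrize[OF \<gamma>2(1,4) _ 2] by (simp_all add: \<beta>2_def[abs_def])
  obtain S1 where S1: "abs_continuous_curve_on 0 (1/2) \<beta>1" "negligible S1" "0 \<in> S1" "1/2 \<in> S1"
    "\<And>t. t \<in> {0..1/2} - S1 \<Longrightarrow> (\<beta>1 has_vector_derivative left_field (\<beta>1 t) (velocity \<beta>1 t)) (at t)"
    by (rule horizontal_onE[OF \<beta>1(1)]) blast
  obtain S2 where S2: "abs_continuous_curve_on (1/2) 1 \<beta>2" "negligible S2" "1/2 \<in> S2" "1 \<in> S2"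
    "\<And>t. t \<in> {1/2..1} - S2 \<Longrightarrow> (\<beta>2 has_vector_derivative left_field (\<beta>2 t) (velocity \<beta>2 t)) (at t)"
    by (rule horizontal_onE[OF \<beta>2(1)]) blast
  \<comment> \<open>At the junction 1/2 the halves may have different derivatives; this point lies
    in both exceptional sets.\<close>
  define \<beta> where "\<beta> t = (if t \<le> 1/2 then \<beta>1 t else \<beta>2 t)" for t
  have \<beta>_left: "\<beta> t = \<beta>1 t" if "t \<le> 1/2" for t using that by (simp add: \<beta>_def)
  have \<beta>_right: "\<beta> t = \<beta>2 t" if "1/2 \<le> t" for t
  proof (cases "t = 1/2")
    case True
    have "\<beta>1 (1/2) = \<beta>2 (1/2)" using \<gamma>1(3) \<gamma>2(2) by (simp add: \<beta>1_def \<beta>2_def)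
    then show ?thesis by (simp add: \<beta>_def True)
  qed (use that in \<open>simp add: \<beta>_def\<close>)
  have der1: "(\<beta> has_vector_derivative left_field (\<beta> t) (velocity \<beta>1 t)) (at t)" if "t \<in> {0..1/2} - S1" for t
  proof -
    have t: "t < 1/2" using that S1(4) by (cases "t = 1/2") auto
    show ?thesis
      using has_vector_derivative_transform_within_open[OF S1(5)[OF that], of "{..<1/2}" \<beta>] t \<beta>_left by simp
  qed
  have der2: "(\<beta> has_vector_derivative left_field (\<beta> t) (velocity \<beta>2 t)) (at t)" if "t \<in> {1/2..1} - S2" for t
  proof -
    have t: "t > 1/2" using that S2(3) by (cases "t = 1/2") auto
    show ?thesis
      using has_vector_derivative_transform_within_open[OF S2(5)[OF that], of "{1/2<..}" \<beta>] t \<beta>_right by simp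
  qed
  have "abs_continuous_curve_on 0 (1/2) \<beta>"
    by (rule abs_continuous_curve_on_Lipschitz_image[OF S1(1), of _ 1]) (simp add: \<beta>_left)
  moreover have "abs_continuous_curve_on (1/2) 1 \<beta>"
    by (rule abs_continuous_curve_on_Lipschitz_image[OF S2(1), of _ 1]) (simp add: \<beta>_right)
  ultimately have ac: "abs_continuous_curve_on 0 1 \<beta>"
    by (rule abs_continuous_curve_on_join) simp_all
  have neg: "negligible (S1 \<union> S2)" using S1(2) S2(2) by simp
  have "horizontal_on 0 1 \<beta>"
  proof (rule horizontal_onI[OF ac neg])
    fix t :: real assume t: "t \<in> {0<..<1}" "t \<notin> S1 \<union> S2"
    show "\<exists>v. (\<beta> has_vector_derivative left_field (\<beta> t) v) (at t)"
    proof (cases "t \<le> 1/2")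
      case True
      show ?thesis by (intro exI, rule der1) (use t True in auto)
    next
      case False
      show ?thesis by (intro exI, rule der2) (use t False in auto)
    qed
  qed
  moreover have "((\<lambda>t. N (velocity \<beta> t)) has_integral l + k) {0..1}"
  proof (rule has_integral_combine[of _ "1/2"])
    show "((\<lambda>t. N (velocity \<beta> t)) has_integral l) {0..1/2}"
      by (rule has_integral_spike[OF S1(2) _ \<beta>1(2)]) (use velocity_eq[OF der1] in auto)
    show "((\<lambda>t. N (velocity \<beta> t)) has_integral k) {1/2..1}"
      by (rule has_integral_spike[OF S2(2) _ \<beta>2(2)]) (use velocity_eq[OF der2] in auto)
  qed simp_all
  moreover have "\<beta> 0 = p" "\<beta> 1 = r" using \<gamma>1(2) \<gamma>2(3) by (simp_all add: \<beta>_def \<beta>1_def \<beta>2_def)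
  ultimately show ?thesis unfolding joined_def by blast
qed

text \<open>Since \<open>symp v v = 0\<close>, the field given by \<open>v\<close> is constant along
  the line through \<open>p\<close> in its own direction; so this line is horizontal with constant
  velocity \<open>v\<close>.\<close>

lemma joined_segment: "joined p (heis_mult p (v, 0)) (N v)"
proof -
  define \<gamma> where "\<gamma> s = heis_mult p (s *\<^sub>R v, 0)" for s
  have eq: "\<gamma> s = p + s *\<^sub>R left_field p v" for s
    by (simp add: \<gamma>_def heis_mult_def left_field_def symp_simps prod_eq_iff)
  have lf: "left_field (\<gamma> s) v = left_field p v" for s
    by (simp add: \<gamma>_def heis_mult_def left_field_def symp_simps)
  have der: "(\<gamma> has_vector_derivative left_field (\<gamma> s) v) (at s)" for s
    unfolding lf unfolding eq by (auto intro!: derivative_eq_intros)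
  have "horizontal_on 0 1 \<gamma>"
  proof (rule horizontal_onI[of _ _ _ "{}"])
    have "norm (\<gamma> s - \<gamma> t) \<le> norm (left_field p v) * norm (s - t)" for s t
      by (simp add: eq flip: scaleR_diff_left)
    then show "abs_continuous_curve_on 0 1 \<gamma>"
      by (intro abs_continuous_curve_on_Lipschitz_image[OF abs_continuous_curve_on_id])
    show "\<exists>v. (\<gamma> has_vector_derivative left_field (\<gamma> t) v) (at t)" for t using der by blast
  qed simp
  moreover have "((\<lambda>t. N (velocity \<gamma> t)) has_integral N v) {0..1}"
    using has_integral_const_real[of "N v" 0 1] by (simp add: velocity_eq[OF der])
  ultimately show ?thesis unfolding joined_def
    by (intro exI[of _ \<gamma>]) (auto simp: eq[of 0], simp add: \<gamma>_def)
qed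

text \<open>The commutator of two horizontal segments is a vertical displacement.\<close>

lemma joined_vertical: "\<exists>l. joined (x, s) (x, t) l"
proof -
  \<comment> \<open>Following v, w, -v, -w returns to \<open>x\<close> and raises the height by
    \<open>symp v w\<close>, which the factor \<open>t - s\<close> adjusts; \<open>undefined\<close>
    is an arbitrary index.\<close>
  define v :: "'n horiz" where "v = ((t - s) *\<^sub>R axis undefined 1, 0)"
  define w :: "'n horiz" where "w = (0, axis undefined 1)"
  have vw: "symp v w = t - s" by (simp add: symp_def v_def w_def inner_axis_axis)
  have step: "joined (y, r) (y + u, r + symp y u / 2) (N u)" for y u r
    using joined_segment[of "(y, r)" u] by (simp add: heis_mult_def)
  define r1 where "r1 = s + symp x v / 2"
  define r2 where "r2 = r1 + symp (x + v) w / 2"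
  define r3 where "r3 = r2 + symp (x + v + w) (- v) / 2"
  have 1: "joined (x, s) (x + v, r1) (N v)" unfolding r1_def by (rule step)
  have 2: "joined (x + v, r1) (x + v + w, r2) (N w)" unfolding r2_def by (rule step)
  have 3: "joined (x + v + w, r2) (x + w, r3) (N (- v))"
    using step[of "x + v + w" r2 "- v"] by (simp add: r3_def)
  have "r3 + symp (x + w) (- w) / 2 = t"
    using vw symp_commute[of w v] by (simp add: r1_def r2_def r3_def symp_simps field_simps)
  then have "joined (x + w, r3) (x, t) (N (- w))"
    using step[of "x + w" r3 "- w"] by simp
  from joined_trans[OF joined_trans[OF joined_trans[OF 1 2] 3] this] show ?thesis by blast
qed

lemma ex_joined: "\<exists>l. joined p q l"
proof -
  obtain x t y s where pq: "p = (x, t)" "q = (y, s)" by (cases p; cases q) blast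
  have "joined p (y, t + symp x (y - x) / 2) (N (y - x))"
    using joined_segment[of p "y - x"] by (simp add: heis_mult_def pq)
  moreover obtain l where "joined (y, t + symp x (y - x) / 2) q l" using joined_vertical pq by blast
  ultimately show ?thesis using joined_trans[of p _ _ q l] by blast
qed

section \<open>The infimum of lengths as a metric, and its symmetries\<close>

lemma cc_dist_le: "joined p q l \<Longrightarrow> cc_dist g p q \<le> l"
  unfolding cc_dist_eq using joined_nonneg by (intro cInf_lower bdd_belowI[of _ 0]) auto

lemma le_cc_dist: "(\<And>l. joined p q l \<Longrightarrow> c \<le> l) \<Longrightarrow> c \<le> cc_dist g p q"
  unfolding cc_dist_eq using ex_joined by (intro cInf_greatest) auto

lemma cc_dist_commute: "cc_dist g p q = cc_dist g q p"
proof -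
  have "joined p q l \<longleftrightarrow> joined q p l" for l using joined_commute by blast
  then show ?thesis by (simp add: cc_dist_eq)
qed

lemma cc_dist_triangle: "cc_dist g p r \<le> cc_dist g p q + cc_dist g q r"
proof -
  have "cc_dist g p r - k \<le> cc_dist g p q" if k: "joined q r k" for k
  proof (rule le_cc_dist)
    fix l assume "joined p q l"
    from cc_dist_le[OF joined_trans[OF this k]] show "cc_dist g p r - k \<le> l" by simp
  qed
  then have "cc_dist g p r - cc_dist g p q \<le> cc_dist g q r"
    by (intro le_cc_dist) (simp add: algebra_simps)
  then show ?thesis by simp
qed

lemma cc_dist_self: "cc_dist g p p = 0"
proof (rule antisym)
  have "heis_mult p (0, 0) = p" by (simp add: heis_mult_def symp_simps)
  then show "cc_dist g p p \<le> 0" using cc_dist_le[OF joined_segment[of p 0]] by (simp add: N_zero)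
  show "0 \<le> cc_dist g p p" by (intro le_cc_dist joined_nonneg)
qed

lemma N_le_cc_dist: "N (fst q - fst p) \<le> cc_dist g p q"
  by (intro le_cc_dist N_le_joined)

text \<open>The reverse inequality follows by translating back. \<open>A\<close> in the proof is the
  linear part of the translation.\<close>

lemma cc_dist_translate_le: "cc_dist g (heis_mult a p) (heis_mult a q) \<le> cc_dist g p q"
proof (rule le_cc_dist)
  fix l assume l: "joined p q l"
  define A where "A x = x + (0, symp (fst a) (fst x) / 2)" for x :: "'n heis"
  have "linear A"
    by (rule linearI) (simp_all add: A_def symp_simps prod_eq_iff add_divide_distrib distrib_left)
  then have "bounded_linear A" by (simp add: linear_conv_bounded_linear)
  moreover have "heis_mult a x = A x + a" for x
    by (simp add: A_def heis_mult_def prod_eq_iff)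
  moreover have "A (left_field x v) = left_field (heis_mult a x) (1 *\<^sub>R v)" for x v
    by (simp add: A_def left_field_def heis_mult_def symp_simps field_simps)
  ultimately have "joined (heis_mult a p) (heis_mult a q) (\<bar>1\<bar> * l)" by (rule joined_linear_image[OF l])
  from cc_dist_le[OF this] show "cc_dist g (heis_mult a p) (heis_mult a q) \<le> l" by simp
qed

text \<open>The automorphic dilations of the group. Heights have weight 2 because
  \<open>symp\<close> is bilinear; this is the source of the square root in
  \<open>cc_dist_vertical\<close>.\<close>

definition dilate :: "real \<Rightarrow> 'n heis \<Rightarrow> 'n heis" where
  "dilate r p = (r *\<^sub>R fst p, r\<^sup>2 * snd p)"

lemma cc_dist_dilate_le: assumes "r > 0" shows "cc_dist g (dilate r p) (dilate r q) \<le> r * cc_dist g p q"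
proof -
  have "cc_dist g (dilate r p) (dilate r q) / r \<le> cc_dist g p q"
  proof (rule le_cc_dist)
    fix l assume l: "joined p q l"
    have "linear (dilate r)"
      by (rule linearI) (simp_all add: dilate_def prod_eq_iff scaleR_add_right distrib_left)
    then have "bounded_linear (dilate r)" by (simp add: linear_conv_bounded_linear)
    moreover have "dilate r x = dilate r x + 0" for x by simp
    moreover have "dilate r (left_field x v) = left_field (dilate r x) (r *\<^sub>R v)" for x v
      by (simp add: dilate_def left_field_def symp_simps power2_eq_square)
    ultimately have "joined (dilate r p) (dilate r q) (\<bar>r\<bar> * l)" by (rule joined_linear_image[OF l])
    from cc_dist_le[OF this] show "cc_dist g (dilate r p) (dilate r q) / r \<le> l"
      using assms by (simp add: field_simps)
  qed
  then show ?thesis using assms by (simp add: field_simps)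
qed

definition \<kappa> :: real where "\<kappa> = cc_dist g (0, 0) (0, 1)"

lemma \<kappa>_pos: "\<kappa> > 0"
proof -
  obtain c where c: "c > 0" "\<And>t l. joined (0, 0) (0, t) l \<Longrightarrow> \<bar>t\<bar> \<le> c * l\<^sup>2"
    by (rule vertical_le_joined) blast
  have "1 / sqrt c \<le> \<kappa>"
    unfolding \<kappa>_def
  proof (rule le_cc_dist)
    fix l assume l: "joined (0, 0) (0, 1) l"
    then have "1 / c \<le> l\<^sup>2" using c(2)[OF l] c(1) by (simp add: field_simps)
    then have "sqrt (1 / c) \<le> l" using joined_nonneg[OF l] by (simp add: real_le_lsqrt)
    then show "1 / sqrt c \<le> l" by (simp add: real_sqrt_divide)
  qed
  moreover have "1 / sqrt c > 0" using c(1) by simp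
  ultimately show ?thesis by linarith
qed

text \<open>Left translation moves one endpoint to the origin; dilations by \<open>sqrt u\<close>
  and by its reciprocal relate the heights \<open>u\<close> and 1 in both directions.\<close>

lemma cc_dist_vertical: "cc_dist g (x, s) (x, t) = \<kappa> * sqrt \<bar>s - t\<bar>"
proof -
  have *: "cc_dist g (x, s) (x, s + u) = cc_dist g (0, 0) (0, u)" for s u
  proof (rule antisym)
    have "heis_mult (x, s) (0, 0) = (x, s)" "heis_mult (x, s) (0, u) = (x, s + u)"
      by (simp_all add: heis_mult_def symp_simps)
    then show "cc_dist g (x, s) (x, s + u) \<le> cc_dist g (0, 0) (0, u)"
      using cc_dist_translate_le[of "(x, s)" "(0, 0)" "(0, u)"] by simp
    have "heis_mult (- x, - s) (x, s) = (0, 0)" "heis_mult (- x, - s) (x, s + u) = (0, u)"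
      by (simp_all add: heis_mult_def symp_simps)
    then show "cc_dist g (0, 0) (0, u) \<le> cc_dist g (x, s) (x, s + u)"
      using cc_dist_translate_le[of "(- x, - s)" "(x, s)" "(x, s + u)"] by simp
  qed
  have pos: "cc_dist g (0, 0) (0, u) = \<kappa> * sqrt u" if "u \<ge> 0" for u
  proof (cases "u = 0")
    case False
    define r where "r = sqrt u"
    have r: "r > 0" "r\<^sup>2 = u" using that False by (auto simp: r_def)
    have "dilate r (0, 0) = (0, 0)" "dilate r (0, 1) = (0, u)"
      "dilate (1 / r) (0, 0) = (0, 0)" "dilate (1 / r) (0, u) = (0, 1)"
      using r False by (simp_all add: dilate_def power_divide)
    then show ?thesis
      using cc_dist_dilate_le[of r "(0, 0)" "(0, 1)"] cc_dist_dilate_le[of "1 / r" "(0, 0)" "(0, u)"] r(1)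
      by (simp add: \<kappa>_def r_def[symmetric] field_simps)
  qed (simp add: cc_dist_self)
  show ?thesis
  proof (cases "s \<le> t")
    case True
    then show ?thesis using *[of s "t - s"] pos[of "t - s"] by simp
  next
    case False
    then show ?thesis using *[of t "s - t"] pos[of "s - t"] cc_dist_commute[of "(x, s)" "(x, t)"] by simp
  qed
qed

lemma Metric_space_cc_dist: "Metric_space UNIV (cc_dist g)"
proof
  show "0 \<le> cc_dist g p q" for p q by (intro le_cc_dist joined_nonneg)
  show "cc_dist g p q = cc_dist g q p" for p q by (rule cc_dist_commute)
  show "cc_dist g p q = 0 \<longleftrightarrow> p = q" for p q
  proof
    assume 0: "cc_dist g p q = 0"
    obtain x s y t where pq: "p = (x, s)" "q = (y, t)" by (cases p; cases q) blast
    have "N (y - x) \<le> 0" using N_le_cc_dist[of q p] 0 by (simp add: pq)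
    then have "y = x" using N_pos[of "y - x"] by force
    then have "sqrt \<bar>s - t\<bar> = 0" using 0 \<kappa>_pos by (simp add: pq cc_dist_vertical)
    with \<open>y = x\<close> show "p = q" by (simp add: pq)
  qed (simp add: cc_dist_self)
  show "cc_dist g p r \<le> cc_dist g p q + cc_dist g q r" for p q r by (rule cc_dist_triangle)
qed

lemma fibred_metric_cc_dist: "fibred_metric (cc_dist g) N \<kappa>"
proof (intro fibred_metric.intro fibred_metric_axioms.intro Metric_space_cc_dist \<kappa>_pos)
  show "cc_dist g (x, s) (x, t) = \<kappa> * sqrt \<bar>s - t\<bar>" for x s t by (rule cc_dist_vertical)
  show "N (c *\<^sub>R v) = \<bar>c\<bar> * N v" for c v by (rule N_scaleR)
  have "(axis undefined 1, 0) \<noteq> (0 :: 'n horiz)" by (simp add: prod_eq_iff axis_eq_0_iff)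
  then show "\<exists>v. N v > 0" using N_pos by blast
  show "N (y - x) \<le> cc_dist g (x, s) (y, t)" for x y s t
    using N_le_cc_dist[of "(y, t)" "(x, s)"] by simp
  show "\<exists>\<sigma>. \<sigma> 0 = t \<and> (\<forall>u v. cc_dist g (x + u *\<^sub>R (y - x), \<sigma> u) (x + v *\<^sub>R (y - x), \<sigma> v)
      \<le> \<bar>u - v\<bar> * N (y - x))" for x y t
  \<comment> \<open>The height of the horizontal lift of the segment. Its points at \<open>u\<close>
    and \<open>v\<close> differ by a right factor \<open>((v - u) *\<^sub>R w, 0)\<close>, so they
    are joined by a horizontal segment of the required length.\<close>
  proof (intro exI[of _ "\<lambda>u. t + u * symp x (y - x) / 2"] conjI allI)
    fix u v
    define w where "w = y - x"
    have "x + u *\<^sub>R w + (v - u) *\<^sub>R w = x + v *\<^sub>R w" by (simp add: scaleR_diff_left)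
    moreover have "symp (x + u *\<^sub>R w) ((v - u) *\<^sub>R w) = (v - u) * symp x w" by (simp add: symp_simps)
    ultimately have "heis_mult (x + u *\<^sub>R w, t + u * symp x w / 2) ((v - u) *\<^sub>R w, 0) = (x + v *\<^sub>R w, t + v * symp x w / 2)"
      by (simp add: heis_mult_def field_simps)
    then have "joined (x + u *\<^sub>R w, t + u * symp x w / 2) (x + v *\<^sub>R w, t + v * symp x w / 2) (N ((v - u) *\<^sub>R w))"
      using joined_segment by metis
    from cc_dist_le[OF this]
    show "cc_dist g (x + u *\<^sub>R (y - x), t + u * symp x (y - x) / 2) (x + v *\<^sub>R (y - x), t + v * symp x (y - x) / 2)
        \<le> \<bar>u - v\<bar> * N (y - x)"
      by (simp add: N_scaleR abs_minus_commute w_def)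
  qed simp
qed

end

subsection \<open>Quasiconformal maps of the Heisenberg group\<close>

text \<open>Clearing the denominator survives the conventions of \<open>ennreal\<close>: for
  \<open>b = 0\<close> the quotient is infinite unless \<open>a = 0\<close>, and for infinite
  \<open>b\<close> the right side is infinite because \<open>c > 0\<close>.\<close>

lemma ennreal_le_mult_of_divide_less:
  fixes a b :: ennreal
  assumes "a / b < ennreal c" "c > 0"
  shows "a \<le> ennreal c * b"
proof (cases "b = 0")
  case True
  then have "a = 0" using assms by (cases "a = 0") (auto simp: divide_ennreal_def ennreal_mult_top)
  then show ?thesis by simp
next
  case b0: False
  show ?thesis
  proof (cases b)
    case (real r)
    then have "r > 0" using b0 by (cases "r = 0") auto
    show ?thesis
    proof (cases a)
      case (real s)
      have "ennreal (s / r) < ennreal c"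
        using assms(1) \<open>r > 0\<close> by (simp add: \<open>a = ennreal s\<close> \<open>0 \<le> s\<close> \<open>b = ennreal r\<close> divide_ennreal)
      then have "s / r < c" using \<open>0 \<le> s\<close> \<open>r > 0\<close> by (simp add: ennreal_less_iff)
      then have "s \<le> c * r" using \<open>r > 0\<close> by (simp add: field_simps)
      then show ?thesis
        using assms(2) by (simp add: \<open>a = ennreal s\<close> \<open>b = ennreal r\<close> ennreal_leI flip: ennreal_mult')
    next
      case top
      then show ?thesis using assms(1) real \<open>r > 0\<close> by (simp add: ennreal_top_divide)
    qed
  next
    case top
    then show ?thesis using assms(2) by (simp add: ennreal_mult_top)
  qed
qed

text \<open>For \<open>t = d q p\<close> the point \<open>q\<close> competes in the supremum and
  \<open>q'\<close> in the infimum of \<open>qc_ratio\<close>. The bound \<open>K + 1\<close> lies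
  strictly above the limit superior and so holds for all small \<open>t > 0\<close>.\<close>

lemma quasiconformal_local_comparison:
  assumes qc: "quasiconformal UNIV d UNIV d' F" and d: "Metric_space UNIV d" and d': "Metric_space UNIV d'"
  obtains \<Lambda> :: real where "\<Lambda> \<ge> 1"
    "\<And>p. \<exists>\<tau>>0. \<forall>q q'. d q p \<le> d q' p \<and> d q p < \<tau> \<longrightarrow> d' (F q) (F p) \<le> \<Lambda> * d' (F q') (F p)"
proof -
  interpret d: Metric_space UNIV d by (rule d)
  interpret d': Metric_space UNIV d' by (rule d')
  obtain K :: real where K: "K \<ge> 1" "\<And>p. Limsup (at_right 0) (\<lambda>t. qc_ratio UNIV d d' F p t) \<le> ennreal K"
    using qc unfolding quasiconformal_def by auto
  have "\<exists>\<tau>>0. \<forall>q q'. d q p \<le> d q' p \<and> d q p < \<tau> \<longrightarrow> d' (F q) (F p) \<le> (K + 1) * d' (F q') (F p)" for p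
  proof -
    have "ennreal K < ennreal (K + 1)" using K(1) by (simp add: ennreal_less_iff)
    with K(2)[of p] have "Limsup (at_right 0) (\<lambda>t. qc_ratio UNIV d d' F p t) < ennreal (K + 1)"
      by (rule le_less_trans)
    then have "eventually (\<lambda>t. qc_ratio UNIV d d' F p t < ennreal (K + 1)) (at_right 0)"
      by (rule Limsup_lessD)
    then obtain \<tau> where \<tau>: "\<tau> > 0" "\<And>t. t > 0 \<Longrightarrow> t < \<tau> \<Longrightarrow> qc_ratio UNIV d d' F p t < ennreal (K + 1)"
      unfolding eventually_at_right_field by blast
    have "d' (F q) (F p) \<le> (K + 1) * d' (F q') (F p)" if q: "d q p \<le> d q' p" "d q p < \<tau>" for q q'
    proof (cases "q = p")
      case True
      then show ?thesis using K(1) by simp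
    next
      case False
      define t where "t = d q p"
      have t: "t > 0" "t < \<tau>" using False q(2) d.mdist_pos_eq[of q p] by (auto simp: t_def)
      let ?a = "SUP x'\<in>{x'\<in>UNIV. d x' p \<le> t}. ennreal (d' (F x') (F p))"
      let ?b = "INF x'\<in>{x'\<in>UNIV. d x' p \<ge> t}. ennreal (d' (F x') (F p))"
      have "ennreal (d' (F q) (F p)) \<le> ?a" by (rule SUP_upper) (simp add: t_def)
      also have "?a \<le> ennreal (K + 1) * ?b"
        using \<tau>(2)[OF t] K(1) unfolding qc_ratio_def by (intro ennreal_le_mult_of_divide_less) auto
      also have "?b \<le> ennreal (d' (F q') (F p))" by (rule INF_lower) (use q(1) in \<open>simp add: t_def\<close>)
      finally have "ennreal (d' (F q) (F p)) \<le> ennreal (K + 1) * ennreal (d' (F q') (F p))"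
        by (simp add: mult_left_mono)
      also have "\<dots> = ennreal ((K + 1) * d' (F q') (F p))" using K(1) by (simp add: ennreal_mult')
      finally show ?thesis using K(1) by (simp add: ennreal_le_iff)
    qed
    with \<tau>(1) show ?thesis by blast
  qed
  then show thesis using K(1) by (intro that[of "K + 1"]) auto
qed

theorem proposition4p5:
  fixes g :: "'n::finite horiz \<Rightarrow> 'n horiz \<Rightarrow> real"
    and F :: "'n heis \<Rightarrow> 'n heis"
  assumes "inner_product g"
    and "quasiconformal UNIV (cc_dist g) UNIV (cc_dist g) F"
    and "\<And>l. vertical_line l \<Longrightarrow> vertical_line (F ` l)"
  shows "biLipschitz UNIV (cc_dist g) UNIV (cc_dist g) F"
proof -
  interpret heis_metric g by unfold_locales (rule assms(1))
  interpret fibred_metric "cc_dist g" N \<kappa> by (rule fibred_metric_cc_dist)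
  obtain \<Lambda> :: real where \<Lambda>: "\<Lambda> \<ge> 1"
    "\<And>p. \<exists>\<tau>>0. \<forall>q q'. cc_dist g q p \<le> cc_dist g q' p \<and> cc_dist g q p < \<tau> \<longrightarrow>
      cc_dist g (F q) (F p) \<le> \<Lambda> * cc_dist g (F q') (F p)"
    by (rule quasiconformal_local_comparison[OF assms(2) Metric_space_cc_dist Metric_space_cc_dist]) blast
  \<comment> \<open>Height 0 is arbitrary, as the whole fibre over \<open>x\<close> lands on one
    vertical line.\<close>
  define f where "f x = fst (F (x, 0))" for x
  have img: "F ` ({x} \<times> UNIV) = {f x} \<times> UNIV" for x
  proof -
    have "vertical_line (F ` ({x} \<times> UNIV))" by (rule assms(3)) (unfold vertical_line_def, blast)
    then obtain y where y: "F ` ({x} \<times> UNIV) = {y} \<times> UNIV" unfolding vertical_line_def by blast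
    have "F (x, 0) \<in> F ` ({x} \<times> UNIV)" by blast
    then have "f x = y" unfolding y f_def by auto
    with y show ?thesis by simp
  qed
  have continuous: "\<exists>\<delta>>0. \<forall>q. cc_dist g p q < \<delta> \<longrightarrow> cc_dist g (G p) (G q) < \<epsilon>"
    if "continuous_map mtopology mtopology G" "\<epsilon> > 0" for G p \<epsilon>
  proof -
    have "\<forall>p\<in>UNIV. \<forall>\<epsilon>>0. \<exists>\<delta>>0. \<forall>q. q \<in> UNIV \<and> cc_dist g p q < \<delta> \<longrightarrow> cc_dist g (G p) (G q) < \<epsilon>"
      using that(1) unfolding metric_continuous_map[OF Metric_space_cc_dist] by (rule conjunct2)
    from this[rule_format, OF UNIV_I that(2), of p] show ?thesis by simp
  qed
  interpret fibred_qc "cc_dist g" N \<kappa> F f \<Lambda>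
  proof
    show "bij F" using assms(2) by (simp add: quasiconformal_def)
    show "F ` ({x} \<times> UNIV) = {f x} \<times> UNIV" for x by (rule img)
    show "\<exists>\<delta>>0. \<forall>q. cc_dist g p q < \<delta> \<longrightarrow> cc_dist g (F p) (F q) < \<epsilon>" if "\<epsilon> > 0" for \<epsilon> p
      by (rule continuous[OF _ that]) (use assms(2) in \<open>simp add: quasiconformal_def\<close>)
    show "\<exists>\<delta>>0. \<forall>q. cc_dist g p q < \<delta> \<longrightarrow> cc_dist g (inv F p) (inv F q) < \<epsilon>" if "\<epsilon> > 0" for \<epsilon> p
      by (rule continuous[OF _ that]) (use assms(2) in \<open>simp add: quasiconformal_def\<close>)
  qed (rule \<Lambda>)+
  obtain L where "L \<ge> 1" "\<And>p q. cc_dist g p q / L \<le> cc_dist g (F p) (F q)"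
    "\<And>p q. cc_dist g (F p) (F q) \<le> L * cc_dist g p q"
    by (rule biLipschitz_of_fibred_qc) blast
  then show ?thesis unfolding biLipschitz_def by (intro conjI exI[of _ L]) auto
qed

end
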